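(* Let $1<\alpha\le 2$ and let $g\in C((0,1],[0,\infty))$ satisfy $\int_0^1 s^{\alpha-1}g(s)\,ds<\infty$. Then the boundary value problem $$D^{\alpha}_{0+}u(t)+g(t)=0,\quad t\in(0,1),\qquad u(0)=0=u(1),$$ is equivalent to the integral equation $$u(t)=\int_0^1 G(t,s)g(s)\,ds,\qquad t\in[0,1];$$ that is, a function $u$ is a solution of the boundary value problem (in the sense specified in the context) if and only if $u(t)=\int_0^1 G(t,s)g(s)\,ds$ for all $t\in[0,1]$. Here $$G(t,s)=\begin{cases}\dfrac{(t(1-s))^{\alpha-1}-(t-s)^{\alpha-1}}{\Gamma(\alpha)}, & 0\le s\le t\le 1,\\[2mm] \dfrac{(t(1-s))^{\alpha-1}}{\Gamma(\alpha)}, & 0\le t\le s\le 1.\end{cases}$$ Moreover, the function $u(t)=\int_0^1 G(t,s)g(s)\,ds$ belongs to $AC[0,1]\cap E_\alpha$, and $D^{\alpha-1}_{0+}u$ is absolutely continuous on every compact subinterval of $(0,1)$.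
   Context: For $\beta>0$, the Riemann-Liouville fractional derivative of order $\beta$ is $$D^{\beta}_{0+}u(t)=\frac{1}{\Gamma(n-\beta)}\Big(\frac{d}{dt}\Big)^n\int_0^t\frac{u(s)}{(t-s)^{\beta-n+1}}\,ds,\qquad n=[\beta]+1,$$ where $[\beta]$ is the integer part of $\beta$. $AC[0,1]$ is the space of absolutely continuous real functions on $[0,1]$. $E_\alpha=\{u\in C[0,1]: t^{\alpha-1}D^{\alpha-1}_{0+}u(t)\in C[0,1]\}$, with norm $\|u\|_{E_\alpha}=\max_{t\in[0,1]}|u(t)|+\max_{t\in[0,1]}|t^{\alpha-1}D^{\alpha-1}_{0+}u(t)|$. The membership $t^{\alpha-1}D^{\alpha-1}_{0+}u(t)\in C[0,1]$ is understood as: this function, defined on the interior of the interval, extends continuously to $[0,1]$. A solution of the boundary value problem means a function $u\in E_\alpha\cap AC[0,1]$ such that $D^{\alpha-1}_{0+}u$ is absolutely continuous on every compact subinterval of $(0,1)$, $u$ satisfies $D^{\alpha}_{0+}u(t)+g(t)=0$ for $t\in(0,1)$, and $u(0)=u(1)=0$. *)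

theory Defs
  imports "HOL-Analysis.Analysis"
begin

text \<open>
  A function on $[0,1]$ is a total function of type \<^typ>\<open>real \<Rightarrow> real\<close>; every notion
  below depends only on its values on $[0,1]$.
\<close>

definition abs_cont_on :: "real \<Rightarrow> real \<Rightarrow> (real \<Rightarrow> real) \<Rightarrow> bool" where
  "abs_cont_on c d f \<longleftrightarrow>
     (\<forall>\<epsilon>>0. \<exists>\<delta>>0. \<forall>(n::nat) a b.
        (\<forall>i<n. c \<le> a i \<and> a i \<le> b i \<and> b i \<le> d) \<and>
        disjoint_family_on (\<lambda>i. {a i<..<b i}) {..<n} \<and>
        (\<Sum>i<n. b i - a i) < \<delta>
        \<longrightarrow> (\<Sum>i<n. \<bar>f (b i) - f (a i)\<bar>) < \<epsilon>)"

definition loc_abs_cont :: "(real \<Rightarrow> real) \<Rightarrow> bool" where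
  "loc_abs_cont f \<longleftrightarrow> (\<forall>c d. 0 < c \<and> c \<le> d \<and> d < 1 \<longrightarrow> abs_cont_on c d f)"

definition RL_order :: "real \<Rightarrow> nat" where
  "RL_order \<beta> = nat \<lfloor>\<beta>\<rfloor> + 1"

definition RL_integral :: "real \<Rightarrow> (real \<Rightarrow> real) \<Rightarrow> real \<Rightarrow> real" where
  "RL_integral \<beta> u t = (LINT s:{0..t}|lborel. u s / (t - s) powr (\<beta> - real (RL_order \<beta>) + 1))"

definition RL_deriv :: "real \<Rightarrow> (real \<Rightarrow> real) \<Rightarrow> real \<Rightarrow> real" where
  "RL_deriv \<beta> u t =
     1 / Gamma (real (RL_order \<beta>) - \<beta>) * (deriv ^^ RL_order \<beta>) (RL_integral \<beta> u) t"

text \<open>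
  The integral and \<^const>\<open>deriv\<close> are total, so \<^const>\<open>RL_deriv\<close> has a value even
  where the derivative does not exist. The next predicate says that it does exist at every point
  of $T$. It is meant for open $T$: there, requiring the $k$-th derivative to be differentiable
  at every point of $T$ for all $k < n$ is $n$-fold differentiability on $T$.
\<close>

definition RL_differentiable_on :: "real \<Rightarrow> (real \<Rightarrow> real) \<Rightarrow> real set \<Rightarrow> bool" where
  "RL_differentiable_on \<beta> u T \<longleftrightarrow>
     (\<forall>t\<in>T. set_integrable lborel {0..t}
               (\<lambda>s. u s / (t - s) powr (\<beta> - real (RL_order \<beta>) + 1))) \<and>
     (\<forall>k<RL_order \<beta>. \<forall>t\<in>T. (deriv ^^ k) (RL_integral \<beta> u) field_differentiable at t)"

definition E_space :: "real \<Rightarrow> (real \<Rightarrow> real) set" where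
  "E_space \<alpha> = {u. continuous_on {0..1} u \<and>
     RL_differentiable_on (\<alpha> - 1) u {0<..<1} \<and>
     (\<exists>h. continuous_on {0..1} h \<and>
          (\<forall>t\<in>{0<..<1}. h t = t powr (\<alpha> - 1) * RL_deriv (\<alpha> - 1) u t))}"

definition bvp_solution :: "real \<Rightarrow> (real \<Rightarrow> real) \<Rightarrow> (real \<Rightarrow> real) \<Rightarrow> bool" where
  "bvp_solution \<alpha> g u \<longleftrightarrow>
     u \<in> E_space \<alpha> \<and> abs_cont_on 0 1 u \<and>
     loc_abs_cont (RL_deriv (\<alpha> - 1) u) \<and>
     RL_differentiable_on \<alpha> u {0<..<1} \<and>
     (\<forall>t\<in>{0<..<1}. RL_deriv \<alpha> u t + g t = 0) \<and>
     u 0 = 0 \<and> u 1 = 0"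

definition Green :: "real \<Rightarrow> real \<Rightarrow> real \<Rightarrow> real" where
  "Green \<alpha> t s =
     (if s \<le> t then ((t * (1 - s)) powr (\<alpha> - 1) - (t - s) powr (\<alpha> - 1)) / Gamma \<alpha>
      else (t * (1 - s)) powr (\<alpha> - 1) / Gamma \<alpha>)"

text \<open>
  The function $g$ is only given on $(0,1]$; the value of \<open>g 0\<close> does not affect the integral.
\<close>

definition Green_op :: "real \<Rightarrow> (real \<Rightarrow> real) \<Rightarrow> real \<Rightarrow> real" where
  "Green_op \<alpha> g t = (LINT s:{0..1}|lborel. Green \<alpha> t s * g s)"

end

theory Submission
  imports Defs
begin

text \<open>
  Put \<open>\<gamma> = \<alpha> - 1\<close>. The kernel satisfies \<open>0 \<le> \<Gamma>(\<alpha>) G(t,s) \<le> s powr \<gamma>\<close>, and its variation in \<open>t\<close> over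
  disjoint intervals of total length \<open>L\<close> is at most \<open>3 (min s L) powr \<gamma>\<close>; with the integrability of
  \<open>s powr \<gamma> * g s\<close> this makes the Green potential \<open>U\<close> well defined and absolutely continuous. For
  \<open>\<gamma> < 1\<close>, Fubini and a Beta integral show that the fractional integral of \<open>U\<close> is, up to the factor
  \<open>\<Gamma>(1 - \<gamma>)\<close>, \<open>P(t) = \<integral> ((1 - s) powr \<gamma> * t - max 0 (t - s)) g(s) ds\<close>, whose derivative is a constant plus
  \<open>\<integral>\<^sub>t\<^sup>1 g\<close>, so that \<open>P'' = - g\<close>. (The integral of \<open>g\<close> over \<open>(0,1)\<close> may diverge, so \<open>G\<close> must not be split.)
  Conversely, the fractional integral of a solution differs from that of \<open>U\<close> by an affine function. It
  vanishes at \<open>0\<close>, so it is the Abel integral of a multiple of \<open>t powr \<gamma>\<close>; injectivity of the Abel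
  integral and the condition at \<open>1\<close> remove this multiple. For \<open>\<gamma> = 1\<close> the Abel kernel degenerates and
  \<open>U = P\<close> directly.
\<close>

section \<open>Power increments over disjoint intervals\<close>

text \<open>Concavity of the power: the difference has derivative \<open>\<gamma> * ((x + d) powr
  (\<gamma> - 1) - x powr (\<gamma> - 1))\<close>, nonpositive because the exponent
  \<open>\<gamma> - 1\<close> is. It is taken only at interior points, where \<open>x > 0\<close>;
  at the endpoints continuity suffices.\<close>

lemma powr_increment_antimono:
  fixes \<gamma> p q d :: real
  assumes "0 < \<gamma>" "\<gamma> \<le> 1" "0 \<le> p" "p \<le> q" "0 \<le> d"
  shows "(q + d) powr \<gamma> - q powr \<gamma> \<le> (p + d) powr \<gamma> - p powr \<gamma>"
proof (rule DERIV_nonpos_imp_decreasing_open[OF \<open>p \<le> q\<close>, where f = "\<lambda>x. (x + d) powr \<gamma> - x powr \<gamma>"])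
  fix x assume "p < x" "x < q"
  hence x: "0 < x" using assms by linarith
  have "((\<lambda>x. (x + d) powr \<gamma> - x powr \<gamma>) has_real_derivative
          \<gamma> * (x + d) powr (\<gamma> - 1) - \<gamma> * x powr (\<gamma> - 1)) (at x)"
    using x assms by (auto intro!: derivative_eq_intros)
  moreover have "(x + d) powr (\<gamma> - 1) \<le> x powr (\<gamma> - 1)"
    using x assms by (intro powr_mono2') auto
  hence "\<gamma> * (x + d) powr (\<gamma> - 1) - \<gamma> * x powr (\<gamma> - 1) \<le> 0"
    using assms by simp
  ultimately show "\<exists>y. ((\<lambda>x. (x + d) powr \<gamma> - x powr \<gamma>) has_real_derivative y) (at x) \<and> y \<le> 0"
    by blast
next
  show "continuous_on {p..q} (\<lambda>x. (x + d) powr \<gamma> - x powr \<gamma>)"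
    using assms by (intro continuous_intros continuous_on_powr') auto
qed

lemma powr_subadditive:
  fixes \<gamma> x y :: real
  assumes "0 < \<gamma>" "\<gamma> \<le> 1" "0 \<le> x" "0 \<le> y"
  shows "(x + y) powr \<gamma> \<le> x powr \<gamma> + y powr \<gamma>"
  using powr_increment_antimono[of \<gamma> 0 x y] assms by simp

text \<open>
  Induction removes the rightmost interval; by concavity its contribution to the power sum is largest
  when the remaining intervals fill up the initial segment.
\<close>

lemma sum_increments_le_strict:
  fixes a b :: "'i \<Rightarrow> real" and f :: "real \<Rightarrow> real"
  assumes "finite I"
    and "\<And>i. i \<in> I \<Longrightarrow> c \<le> a i \<and> a i < b i \<and> b i \<le> d" and "c \<le> d"
    and "disjoint_family_on (\<lambda>i. {a i<..<b i}) I"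
    and "\<And>x y. c \<le> x \<Longrightarrow> x \<le> y \<Longrightarrow> y \<le> d \<Longrightarrow> f x \<le> f y"
  shows "(\<Sum>i\<in>I. f (b i) - f (a i)) \<le> f d - f c"
    and "0 < \<gamma> \<Longrightarrow> \<gamma> \<le> 1 \<Longrightarrow> 0 \<le> c \<Longrightarrow>
      (\<Sum>i\<in>I. b i powr \<gamma> - a i powr \<gamma>) \<le> (\<Sum>i\<in>I. b i - a i) powr \<gamma>"
proof -
  \<comment> \<open>The middle conjunct strengthens the induction: for \<open>c \<ge> 0\<close> it
    bounds the total length of the intervals to the left of \<open>a x\<close> by
    \<open>a x\<close>, so that concavity can compare the two increments. The endpoint
    \<open>d\<close> varies because the induction hypothesis is applied with \<open>a x\<close> in
    its place.\<close>
  have *: "(\<Sum>i\<in>I. f (b i) - f (a i)) \<le> f d - f c \<and> (\<Sum>i\<in>I. b i - a i) \<le> d - c \<and>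
    (0 < \<gamma> \<longrightarrow> \<gamma> \<le> 1 \<longrightarrow> 0 \<le> c \<longrightarrow>
      (\<Sum>i\<in>I. b i powr \<gamma> - a i powr \<gamma>) \<le> (\<Sum>i\<in>I. b i - a i) powr \<gamma>)"
    using assms
  proof (induction I arbitrary: d rule: finite_ranking_induct[where f = b])
    case empty
    then show ?case by auto
  next
    case (insert x S)
    show ?case
    proof (cases "x \<in> S")
      case True
      show ?thesis
        using insert.prems unfolding insert_absorb[OF True] by (rule insert.IH)
    next
      case False
      have x: "c \<le> a x" "a x < b x" "b x \<le> d" using insert.prems by auto
      have le: "b y \<le> a x" if "y \<in> S" for y
      proof (rule ccontr)
        assume n: "\<not> b y \<le> a x"
        have "{a y<..<b y} \<inter> {a x<..<b x} = {}"
          using disjoint_family_onD[OF insert.prems(3), of y x] that False by auto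
        moreover have "a y < b y" "b y \<le> b x" using insert that by auto
        \<comment> \<open>Since \<open>b y \<le> b x\<close>, the overlap runs from
          \<open>max (a x) (a y)\<close> to \<open>b y\<close>; its midpoint lies in both
          intervals.\<close>
        ultimately have "(max (a x) (a y) + b y) / 2 \<in> {}"
          using n x by (auto simp: max_def split: if_splits)
        thus False by simp
      qed
      have IH: "(\<Sum>i\<in>S. f (b i) - f (a i)) \<le> f (a x) - f c"
        "(\<Sum>i\<in>S. b i - a i) \<le> a x - c"
        "0 < \<gamma> \<longrightarrow> \<gamma> \<le> 1 \<longrightarrow> 0 \<le> c \<longrightarrow>
          (\<Sum>i\<in>S. b i powr \<gamma> - a i powr \<gamma>) \<le> (\<Sum>i\<in>S. b i - a i) powr \<gamma>"
        using insert.IH[of "a x"] insert.prems le x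
          disjoint_family_on_mono[OF subset_insertI insert.prems(3)] by auto
      have f: "f (b x) \<le> f d" using insert.prems(4)[of "b x" d] x by auto
      have pos: "0 \<le> (\<Sum>i\<in>S. b i - a i)"
        using insert.prems by (intro sum_nonneg) (auto simp: less_imp_le)
      have "(b x) powr \<gamma> - (a x) powr \<gamma> + (\<Sum>i\<in>S. b i powr \<gamma> - a i powr \<gamma>)
          \<le> ((b x - a x) + (\<Sum>i\<in>S. b i - a i)) powr \<gamma>" if "0 < \<gamma>" "\<gamma> \<le> 1" "0 \<le> c"
      proof -
        have "(\<Sum>i\<in>S. b i - a i) \<le> a x" using IH(2) that by linarith
        from powr_increment_antimono[OF that(1,2) pos this, of "b x - a x"] x IH(3) that
        show ?thesis by (simp add: add.commute)
      qed
      then show ?thesis using IH f x False insert.hyps by auto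
    qed
  qed
  show "(\<Sum>i\<in>I. f (b i) - f (a i)) \<le> f d - f c" using * by blast
  show "(\<Sum>i\<in>I. b i powr \<gamma> - a i powr \<gamma>) \<le> (\<Sum>i\<in>I. b i - a i) powr \<gamma>"
    if "0 < \<gamma>" "\<gamma> \<le> 1" "0 \<le> c" using * that by blast
qed

text \<open>Degenerate intervals are discarded first: one with \<open>a i = b i\<close> may sit
  inside another interval without violating disjointness, which would break the left-to-right
  ordering behind the strict version. Its increment is zero.\<close>

lemma
  fixes a b :: "'i \<Rightarrow> real"
  assumes "finite I"
    and "\<And>i. i \<in> I \<Longrightarrow> c \<le> a i \<and> a i \<le> b i \<and> b i \<le> d" and "c \<le> d"
    and "disjoint_family_on (\<lambda>i. {a i<..<b i}) I"
  shows sum_increments_le: "(\<And>x y. c \<le> x \<Longrightarrow> x \<le> y \<Longrightarrow> y \<le> d \<Longrightarrow> f x \<le> f y) \<Longrightarrow>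
      (\<Sum>i\<in>I. f (b i) - f (a i)) \<le> f d - (f c :: real)"
    and sum_powr_increments_le: "0 < \<gamma> \<Longrightarrow> \<gamma> \<le> 1 \<Longrightarrow> 0 \<le> c \<Longrightarrow>
      (\<Sum>i\<in>I. b i powr \<gamma> - a i powr \<gamma>) \<le> (\<Sum>i\<in>I. b i - a i) powr \<gamma>"
proof -
  define J where "J = {i\<in>I. a i < b i}"
  have J: "finite J" "\<And>i. i \<in> J \<Longrightarrow> c \<le> a i \<and> a i < b i \<and> b i \<le> d"
    "disjoint_family_on (\<lambda>i. {a i<..<b i}) J"
    using assms disjoint_family_on_mono[of J I] by (auto simp: J_def)
  have eq: "(\<Sum>i\<in>I. h (b i) - h (a i)) = (\<Sum>i\<in>J. h (b i) - h (a i))" for h :: "real \<Rightarrow> real"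
  proof (rule sum.mono_neutral_right)
    show "\<forall>i\<in>I - J. h (b i) - h (a i) = 0"
      using assms(2) by (force simp: J_def not_less intro: arg_cong[of _ _ h])
  qed (use assms in \<open>auto simp: J_def\<close>)
  show "(\<Sum>i\<in>I. f (b i) - f (a i)) \<le> f d - f c"
    if "\<And>x y. c \<le> x \<Longrightarrow> x \<le> y \<Longrightarrow> y \<le> d \<Longrightarrow> f x \<le> f y"
    unfolding eq using J assms(3) that by (intro sum_increments_le_strict(1)) auto
  show "(\<Sum>i\<in>I. b i powr \<gamma> - a i powr \<gamma>) \<le> (\<Sum>i\<in>I. b i - a i) powr \<gamma>"
    if "0 < \<gamma>" "\<gamma> \<le> 1" "0 \<le> c"
    unfolding eq[of "\<lambda>x. x powr \<gamma>"] eq[of "\<lambda>x. x"]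
    \<comment> \<open>\<open>f\<close> does not occur in this conclusion and has to be chosen
      explicitly; the identity is nondecreasing.\<close>
    using J assms(3) that by (intro sum_increments_le_strict(2)[where f = "\<lambda>x. x"]) auto
qed

section \<open>The Green kernel\<close>

text \<open>
  Since \<open>0 powr \<gamma> = 0\<close> for \<open>\<gamma> > 0\<close>, truncating \<open>t - s\<close> at \<open>0\<close> merges the two branches of the Green function.
\<close>

definition green_kernel :: "real \<Rightarrow> real \<Rightarrow> real \<Rightarrow> real" where
  "green_kernel \<gamma> t s = (t * (1 - s)) powr \<gamma> - (max 0 (t - s)) powr \<gamma>"

lemma Green_eq: "Green \<alpha> t s = green_kernel (\<alpha> - 1) t s / Gamma \<alpha>"
  by (auto simp: Green_def green_kernel_def max_def)

text \<open>The upper bound is subadditivity for \<open>1 = s + (1 - s)\<close>. It keeps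
  \<open>1 - (1 - s) powr \<gamma>\<close> integrable against \<open>g\<close> even when
  \<open>g\<close> itself is not integrable near \<open>0\<close>.\<close>

lemma one_minus_powr_bounds:
  fixes \<gamma> s :: real
  assumes "0 < \<gamma>" "\<gamma> \<le> 1" "0 \<le> s" "s \<le> 1"
  shows "0 \<le> 1 - (1 - s) powr \<gamma>" "1 - (1 - s) powr \<gamma> \<le> s powr \<gamma>"
  using powr_le1[of \<gamma> "1 - s"] powr_subadditive[of \<gamma> s "1 - s"] assms by auto

text \<open>From \<open>t * s \<le> s\<close> follows \<open>t - s \<le> t * (1 - s)\<close>, hence
  nonnegativity. Conversely \<open>t * (1 - s) \<le> t\<close>, and subadditivity splits
  \<open>t powr \<gamma>\<close> at \<open>s\<close>. The bound \<open>s powr \<gamma>\<close> is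
  the weight for which \<open>g\<close> is assumed integrable.\<close>

lemma green_kernel_bounds:
  assumes "0 < \<gamma>" "\<gamma> \<le> 1" "0 \<le> s" "s \<le> 1" "0 \<le> t" "t \<le> 1"
  shows "0 \<le> green_kernel \<gamma> t s" "green_kernel \<gamma> t s \<le> s powr \<gamma>"
proof -
  have "t * s \<le> s" "t * s \<le> t"
    using assms mult_left_le_one_le[of s t] mult_left_le[of s t] by auto
  hence "max 0 (t - s) \<le> t * (1 - s)" using assms by (auto simp: algebra_simps max_def)
  thus "0 \<le> green_kernel \<gamma> t s"
    unfolding green_kernel_def using assms powr_mono2[of \<gamma> "max 0 (t - s)" "t * (1 - s)"] by auto
  have 1: "t * (1 - s) \<le> t" using assms by (simp add: algebra_simps)
  hence "(t * (1 - s)) powr \<gamma> \<le> t powr \<gamma>" using assms by (intro powr_mono2) auto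
  moreover have "t powr \<gamma> \<le> s powr \<gamma> + (max 0 (t - s)) powr \<gamma>"
  proof (cases "t \<le> s")
    case True
    thus ?thesis using assms by (simp add: powr_mono2 add_increasing2)
  next
    case False
    thus ?thesis using powr_subadditive[of \<gamma> s "t - s"] assms by simp
  qed
  ultimately show "green_kernel \<gamma> t s \<le> s powr \<gamma>" by (simp add: green_kernel_def)
qed

text \<open>
  The bound by the length of the intervals is absolute continuity in \<open>t\<close>; the bound by \<open>s powr \<gamma>\<close> comes from
  writing the kernel as \<open>p - q - r\<close> with nondecreasing functions whose increments over \<open>[0,1]\<close> are
  at most \<open>s powr \<gamma>\<close>. Only their minimum is integrable against \<open>g\<close> with an arbitrarily small integral.
\<close>

lemma green_kernel_variation:
  fixes a b :: "'i \<Rightarrow> real"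
  assumes \<gamma>: "0 < \<gamma>" "\<gamma> \<le> 1" and s: "0 \<le> s" "s \<le> 1" and "finite I"
    and ab: "\<And>i. i \<in> I \<Longrightarrow> 0 \<le> a i \<and> a i \<le> b i \<and> b i \<le> 1"
    and disj: "disjoint_family_on (\<lambda>i. {a i<..<b i}) I"
  shows "(\<Sum>i\<in>I. \<bar>green_kernel \<gamma> (b i) s - green_kernel \<gamma> (a i) s\<bar>)
    \<le> 3 * (min s (\<Sum>i\<in>I. b i - a i)) powr \<gamma>" (is "?V \<le> _")
proof -
  let ?L = "\<Sum>i\<in>I. b i - a i"
  have L: "0 \<le> ?L" using ab by (intro sum_nonneg) auto
  have incr: "(\<Sum>i\<in>I. f (b i) - f (a i)) \<le> f 1 - f 0"
    if "\<And>x y. 0 \<le> x \<Longrightarrow> x \<le> y \<Longrightarrow> y \<le> 1 \<Longrightarrow> f x \<le> f y" for f :: "real \<Rightarrow> real"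
    using assms that by (intro sum_increments_le) auto
  have "?V \<le> 2 * ?L powr \<gamma>"
  proof -
    have 1: "(\<Sum>i\<in>I. b i powr \<gamma> - a i powr \<gamma>) \<le> ?L powr \<gamma>"
      using assms by (intro sum_powr_increments_le[where c = 0 and d = 1]) auto
    \<comment> \<open>Shifting by \<open>s\<close> and truncating at \<open>0\<close> yields
      intervals that are still disjoint, possibly degenerate, and of no larger total length, so the
      power estimate applies to them.\<close>
    have "(\<Sum>i\<in>I. (max 0 (b i - s)) powr \<gamma> - (max 0 (a i - s)) powr \<gamma>)
        \<le> (\<Sum>i\<in>I. max 0 (b i - s) - max 0 (a i - s)) powr \<gamma>"
    proof (rule sum_powr_increments_le[where c = 0 and d = 1])
      show "disjoint_family_on (\<lambda>i. {max 0 (a i - s)<..<max 0 (b i - s)}) I"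
      proof (clarsimp simp: disjoint_family_on_def set_eq_iff)
        fix m n x
        assume mn: "m \<in> I" "n \<in> I" "m \<noteq> n" and x: "0 < x" "a m - s < x" "a n - s < x"
          "x < max 0 (b m - s)" "x < max 0 (b n - s)"
        from disjoint_family_onD[OF disj mn] have "x + s \<notin> {a m<..<b m} \<inter> {a n<..<b n}" by simp
        thus False using x by (auto simp: less_max_iff_disj)
      qed
    qed (use assms ab in \<open>force simp: max_def\<close>)+
    also have "\<dots> \<le> ?L powr \<gamma>"
      using ab \<gamma> by (intro powr_mono2 sum_mono sum_nonneg) (force simp: max_def)+
    finally have 2: "(\<Sum>i\<in>I. (max 0 (b i - s)) powr \<gamma> - (max 0 (a i - s)) powr \<gamma>) \<le> ?L powr \<gamma>" .
    have "?V \<le> (\<Sum>i\<in>I. (b i powr \<gamma> - a i powr \<gamma>) +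
        ((max 0 (b i - s)) powr \<gamma> - (max 0 (a i - s)) powr \<gamma>))"
    proof (rule sum_mono)
      fix i assume i: "i \<in> I"
      have "0 \<le> b i powr \<gamma> - a i powr \<gamma>" using ab[OF i] \<gamma> by (simp add: powr_mono2)
      moreover have "0 \<le> (1 - s) powr \<gamma>" "(1 - s) powr \<gamma> \<le> 1"
        using s \<gamma> by (auto intro: powr_le1)
      ultimately have "0 \<le> (b i powr \<gamma> - a i powr \<gamma>) * (1 - s) powr \<gamma>"
        "(b i powr \<gamma> - a i powr \<gamma>) * (1 - s) powr \<gamma> \<le> b i powr \<gamma> - a i powr \<gamma>"
        by (auto simp: mult_left_le)
      moreover have "(max 0 (a i - s)) powr \<gamma> \<le> (max 0 (b i - s)) powr \<gamma>"
        using ab[OF i] \<gamma> by (intro powr_mono2) auto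
      moreover have "green_kernel \<gamma> (b i) s - green_kernel \<gamma> (a i) s =
          (b i powr \<gamma> - a i powr \<gamma>) * (1 - s) powr \<gamma> -
          ((max 0 (b i - s)) powr \<gamma> - (max 0 (a i - s)) powr \<gamma>)"
        using powr_mult[of "b i" "1 - s" \<gamma>] powr_mult[of "a i" "1 - s" \<gamma>] ab[OF i] s
        by (simp only: green_kernel_def left_diff_distrib)
      ultimately show "\<bar>green_kernel \<gamma> (b i) s - green_kernel \<gamma> (a i) s\<bar> \<le>
         (b i powr \<gamma> - a i powr \<gamma>) + ((max 0 (b i - s)) powr \<gamma> - (max 0 (a i - s)) powr \<gamma>)"
        by linarith
    qed
    also have "\<dots> \<le> 2 * ?L powr \<gamma>" using 1 2 by (subst sum.distrib) linarith
    finally show ?thesis .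
  qed
  moreover have "?V \<le> 3 * s powr \<gamma>"
  proof -
    define p where "p = (\<lambda>t::real. (min t s) powr \<gamma>)"
    \<comment> \<open>\<open>q\<close> is the excess in the subadditivity inequality for splitting
      \<open>t\<close> into \<open>min t s\<close> and \<open>max 0 (t - s)\<close>. It vanishes up
      to \<open>s\<close>, is nonnegative beyond \<open>s\<close>, and grows there by concavity;
      these are the three cases below.\<close>
    define q where "q = (\<lambda>t::real. (min t s) powr \<gamma> - t powr \<gamma> + (max 0 (t - s)) powr \<gamma>)"
    define r where "r = (\<lambda>t::real. t powr \<gamma> * (1 - (1 - s) powr \<gamma>))"
    have p: "p x \<le> p y" if "0 \<le> x" "x \<le> y" "y \<le> 1" for x y
      unfolding p_def using that s \<gamma> by (intro powr_mono2) auto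
    have r: "r x \<le> r y" if "0 \<le> x" "x \<le> y" "y \<le> 1" for x y
      unfolding r_def using that s \<gamma> one_minus_powr_bounds[OF \<gamma> s]
      by (intro mult_right_mono powr_mono2) auto
    have q: "q x \<le> q y" if "0 \<le> x" "x \<le> y" "y \<le> 1" for x y
    proof -
      consider "y \<le> s" | "x \<le> s" "s < y" | "s < x" by linarith
      thus ?thesis
      proof cases
        case 2
        then show ?thesis using powr_subadditive[OF \<gamma>, of s "y - s"] s by (simp add: q_def)
      next
        case 3
        then show ?thesis
          using powr_increment_antimono[OF \<gamma>, of "x - s" x "y - x"] s that by (simp add: q_def)
      qed (use that in \<open>simp add: q_def\<close>)
    qed
    have "?V \<le> (\<Sum>i\<in>I. (p (b i) - p (a i)) + (q (b i) - q (a i)) + (r (b i) - r (a i)))"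
    proof (rule sum_mono)
      fix i assume i: "i \<in> I"
      have k: "green_kernel \<gamma> t s = p t - q t - r t" if "0 \<le> t" for t
        using powr_mult[of t "1 - s" \<gamma>] that s
        unfolding green_kernel_def p_def q_def r_def by (simp add: algebra_simps)
      show "\<bar>green_kernel \<gamma> (b i) s - green_kernel \<gamma> (a i) s\<bar> \<le>
          (p (b i) - p (a i)) + (q (b i) - q (a i)) + (r (b i) - r (a i))"
        using ab[OF i] p[of "a i" "b i"] q[of "a i" "b i"] r[of "a i" "b i"] k[of "a i"] k[of "b i"]
        by linarith
    qed
    also have "\<dots> \<le> (p 1 - p 0) + (q 1 - q 0) + (r 1 - r 0)"
      using incr[of p] incr[of q] incr[of r] p q r by (simp only: sum.distrib) (meson add_mono)
    also have "\<dots> \<le> 3 * s powr \<gamma>"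
      using s \<gamma> one_minus_powr_bounds[OF \<gamma> s] by (simp add: p_def q_def r_def)
    finally show ?thesis .
  qed
  moreover have "2 * ?L powr \<gamma> \<le> 3 * ?L powr \<gamma>" by simp
  ultimately show ?thesis by (auto simp: min_def intro: order_trans)
qed

section \<open>Abel integrals\<close>

text \<open>An affine substitution reduces the claim to the unit interval, where nonnegativity turns
  the gauge integral into a Lebesgue integral. The form with \<open>has_bochner_integral\<close>
  delivers the value together with the integrability that the Fubini arguments require.\<close>

lemma has_bochner_integral_Beta:
  fixes a b p q :: real
  assumes ab: "0 < a" "0 < b" and "p < q"
  shows "has_bochner_integral lborel
    (\<lambda>x. indicator {p<..<q} x * ((x - p) powr (a - 1) * (q - x) powr (b - 1)))
    (Beta a b * (q - p) powr (a + b - 1))"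
proof -
  let ?f = "\<lambda>x. x powr (a - 1) * (1 - x) powr (b - 1) :: real"
  have B: "0 \<le> Beta a b" using ab by (simp add: Beta_def)
  have "(?f has_integral Beta a b) {0<..<1}"
    using has_integral_Beta_real[OF ab] by (simp add: has_integral_Icc_iff_Ioo)
  hence "integral\<^sup>N lborel (\<lambda>x. indicator {0<..<1} x * ?f x) = Beta a b"
    by (intro nn_integral_has_integral_lebesgue) auto
  hence 1: "has_bochner_integral lborel (\<lambda>x. indicator {0<..<1} x * ?f x) (Beta a b)"
    using B by (intro has_bochner_integral_nn_integral) (auto simp: indicator_def)
  \<comment> \<open>The two powers scale by \<open>(q - p) powr (a + b - 2)\<close>; the remaining
    factor \<open>q - p\<close> of the claimed value is the Jacobian.\<close>
  have 2: "indicator {p<..<q} (p + (q - p) * x) *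
      ((p + (q - p) * x - p) powr (a - 1) * (q - (p + (q - p) * x)) powr (b - 1)) =
      (indicator {0<..<1} x * ?f x) * (q - p) powr (a + b - 2)" for x
  proof (cases "x \<in> {0<..<1}")
    case True
    have e: "q - (p + (q - p) * x) = (q - p) * (1 - x)" by (simp add: algebra_simps)
    have "(q - p) * x < q - p" "0 < (q - p) * x"
      using True assms by auto
    hence "p + (q - p) * x \<in> {p<..<q}" unfolding greaterThanLessThan_iff by linarith
    moreover have "((q - p) * x) powr (a - 1) * ((q - p) * (1 - x)) powr (b - 1) =
        ?f x * ((q - p) powr (a - 1) * (q - p) powr (b - 1))"
      using True assms by (simp add: powr_mult)
    moreover have "(q - p) powr (a - 1) * (q - p) powr (b - 1) = (q - p) powr (a + b - 2)"
      by (simp flip: powr_add)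
    ultimately show ?thesis unfolding e using True by simp
  next
    case False
    have "p + (q - p) * x \<notin> {p<..<q}"
    proof
      assume "p + (q - p) * x \<in> {p<..<q}"
      hence "0 < (q - p) * x" "(q - p) * x < (q - p) * 1"
        unfolding greaterThanLessThan_iff mult_1_right by linarith+
      hence "0 < x" "x < 1"
        using \<open>p < q\<close> mult_less_cancel_left_pos[of "q - p" x 1]
        by (simp_all only: zero_less_mult_iff) auto
      thus False using False by simp
    qed
    thus ?thesis using False by simp
  qed
  have h: "(q - p) powr (a + b - 1) = (q - p) powr (a + b - 2) * (q - p)"
    using assms powr_add[of "q - p" "a + b - 2" 1] by simp
  have 3: "(Beta a b * (q - p) powr (a + b - 1)) /\<^sub>R \<bar>q - p\<bar> = Beta a b * (q - p) powr (a + b - 2)"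
    unfolding h using assms by simp
  have "has_bochner_integral lborel (\<lambda>x. indicator {p<..<q} (p + (q - p) * x) *
      ((p + (q - p) * x - p) powr (a - 1) * (q - (p + (q - p) * x)) powr (b - 1)))
      ((Beta a b * (q - p) powr (a + b - 1)) /\<^sub>R \<bar>q - p\<bar>)"
    unfolding 2 3 by (intro has_bochner_integral_mult_left 1)
  moreover have "q - p \<noteq> 0" using \<open>p < q\<close> by simp
  ultimately show ?thesis
    using lborel_has_bochner_integral_real_affine_iff[of "q - p" _ _ p] by blast
qed

lemma integral_swap_lborel:
  fixes f :: "real \<Rightarrow> real \<Rightarrow> real"
  assumes "case_prod f \<in> borel_measurable (lborel \<Otimes>\<^sub>M lborel)"
    and "\<And>x. integrable lborel (f x)"
    and "integrable lborel (\<lambda>x. \<integral>y. \<bar>f x y\<bar> \<partial>lborel)"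
  shows "(\<integral>y. (\<integral>x. f x y \<partial>lborel) \<partial>lborel) = (\<integral>x. (\<integral>y. f x y \<partial>lborel) \<partial>lborel)"
  using assms by (intro lborel_pair.Fubini_integral lborel_pair.Fubini_integrable) auto

text \<open>For \<open>0 < \<gamma> < 1\<close> this is the fractional integral of order
  \<open>1 - \<gamma>\<close> without its Gamma factor, which stays in \<open>RL_deriv\<close>. At
  \<open>s = t\<close> the quotient has the default value \<open>0\<close>, on a null set.\<close>

definition abel_integral :: "real \<Rightarrow> (real \<Rightarrow> real) \<Rightarrow> real \<Rightarrow> real" where
  "abel_integral \<gamma> u t = (LINT s:{0..t}|lborel. u s / (t - s) powr \<gamma>)"

lemma abel_kernel_integrable:
  fixes \<gamma> t :: real
  assumes "\<gamma> < 1" "0 < t"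
  shows "set_integrable lborel {0..t} (\<lambda>s. 1 / (t - s) powr \<gamma>)"
    and "(LINT s:{0..t}|lborel. 1 / (t - s) powr \<gamma>) = t powr (1 - \<gamma>) / (1 - \<gamma>)"
proof -
  have "has_bochner_integral lborel
    (\<lambda>s. indicator {0<..<t} s * ((s - 0) powr (1 - 1) * (t - s) powr ((1 - \<gamma>) - 1)))
    (Beta 1 (1 - \<gamma>) * (t - 0) powr (1 + (1 - \<gamma>) - 1))"
    using assms by (intro has_bochner_integral_Beta) auto
  also have "?this \<longleftrightarrow> has_bochner_integral lborel (\<lambda>s. indicator {0..t} s * (1 / (t - s) powr \<gamma>))
      (Beta 1 (1 - \<gamma>) * (t - 0) powr (1 + (1 - \<gamma>) - 1))"
  proof (intro has_bochner_integral_cong_AE)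
    show "AE s in lborel. indicator {0<..<t} s * ((s - 0) powr (1 - 1) * (t - s) powr ((1 - \<gamma>) - 1))
        = indicator {0..t} s * (1 / (t - s) powr \<gamma>)"
      using AE_lborel_singleton[of 0] AE_lborel_singleton[of t]
      by eventually_elim (auto simp: indicator_def powr_minus_divide)
  qed auto
  also have "Beta 1 (1 - \<gamma>) = 1 / (1 - \<gamma>)"
  proof -
    have "1 - \<gamma> \<notin> \<int>\<^sub>\<le>\<^sub>0" using assms by (auto dest: nonpos_Ints_nonpos)
    hence "Gamma (1 + (1 - \<gamma>)) = (1 - \<gamma>) * Gamma (1 - \<gamma>)"
      using Gamma_plus1[of "1 - \<gamma>"] by (simp add: add.commute)
    moreover have "0 < Gamma (1 - \<gamma>)" using assms by (intro Gamma_real_pos) simp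
    ultimately show ?thesis using assms by (simp add: Beta_def less_imp_neq[symmetric])
  qed
  finally show "set_integrable lborel {0..t} (\<lambda>s. 1 / (t - s) powr \<gamma>)"
    "(LINT s:{0..t}|lborel. 1 / (t - s) powr \<gamma>) = t powr (1 - \<gamma>) / (1 - \<gamma>)"
    by (auto simp: set_integrable_def set_lebesgue_integral_def has_bochner_integral_iff)
qed

text \<open>A bounded function is majorised by a multiple of the Abel kernel. The explicit bound
  tends to \<open>0\<close> with \<open>t\<close>, which later removes a constant of
  integration.\<close>

lemma abel_integrable:
  fixes \<gamma> t :: real
  assumes "\<gamma> < 1" "0 < t" "t \<le> 1" and u: "continuous_on {0..1} u"
  shows "set_integrable lborel {0..t} (\<lambda>s. u s / (t - s) powr \<gamma>)"
    and "(\<And>s. s \<in> {0..1} \<Longrightarrow> \<bar>u s\<bar> \<le> M) \<Longrightarrow>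
      \<bar>abel_integral \<gamma> u t\<bar> \<le> M * (t powr (1 - \<gamma>) / (1 - \<gamma>))"
proof -
  have int: "set_integrable lborel {0..t} (\<lambda>s. M * (1 / (t - s) powr \<gamma>))" for M
    using integrable_mult_right[OF abel_kernel_integrable(1)[OF assms(1,2), unfolded set_integrable_def], of M]
    by (simp add: set_integrable_def mult.commute)
  have meas: "set_borel_measurable lborel {0..t} (\<lambda>s. u s / (t - s) powr \<gamma>)"
  proof -
    have [measurable]: "(\<lambda>s. indicator {0..t} s *\<^sub>R u s) \<in> borel_measurable borel"
      using assms by (intro borel_measurable_continuous_on_indicator continuous_on_subset[OF u]) auto
    have "(\<lambda>s. (indicator {0..t} s *\<^sub>R u s) / (t - s) powr \<gamma>) \<in> borel_measurable lborel"
      by measurable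
    thus ?thesis by (simp add: set_borel_measurable_def)
  qed
  obtain M where M: "\<And>s. s \<in> {0..1} \<Longrightarrow> \<bar>u s\<bar> \<le> M"
    using compact_imp_bounded[OF compact_continuous_image[OF u]]
    unfolding bounded_iff by (metis compact_Icc imageI real_norm_def)
  show i: "set_integrable lborel {0..t} (\<lambda>s. u s / (t - s) powr \<gamma>)"
    using assms M
    by (intro set_integrable_bound[OF int[of M] meas])
       (auto intro!: AE_I2 divide_right_mono order_trans[OF _ abs_ge_self])
  show "\<bar>abel_integral \<gamma> u t\<bar> \<le> M * (t powr (1 - \<gamma>) / (1 - \<gamma>))"
    if "\<And>s. s \<in> {0..1} \<Longrightarrow> \<bar>u s\<bar> \<le> M" for M
  proof -
    have "\<bar>abel_integral \<gamma> u t\<bar> \<le> (LINT s:{0..t}|lborel. \<bar>u s / (t - s) powr \<gamma>\<bar>)"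
      unfolding abel_integral_def set_lebesgue_integral_def
      by (rule order_trans[OF integral_abs_bound]) (simp add: abs_mult)
    also have "\<dots> \<le> (LINT s:{0..t}|lborel. M * (1 / (t - s) powr \<gamma>))"
      using that assms by (intro set_integral_mono set_integrable_abs i int)
        (auto intro!: divide_right_mono)
    also have "\<dots> = M * (LINT s:{0..t}|lborel. 1 / (t - s) powr \<gamma>)"
      by (rule set_integral_mult_right)
    finally show ?thesis by (simp only: abel_kernel_integrable(2)[OF assms(1,2)])
  qed
qed

text \<open>The Beta parameters \<open>1 + \<gamma>\<close> and \<open>1 - \<gamma>\<close> add up
  to \<open>2\<close>, so the result is linear in \<open>t - s\<close>. For \<open>t \<le> s\<close>
  the integrand vanishes.\<close>

lemma abel_shifted_powr:
  fixes \<gamma> s t :: real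
  assumes \<gamma>: "0 < \<gamma>" "\<gamma> < 1" and s: "0 \<le> s" and t: "0 < t"
  shows "has_bochner_integral lborel
    (\<lambda>x. indicator {0..t} x * ((max 0 (x - s)) powr \<gamma> / (t - x) powr \<gamma>))
    (Gamma (1 + \<gamma>) * Gamma (1 - \<gamma>) * max 0 (t - s))"
proof (cases "s < t")
  case True
  have "has_bochner_integral lborel
    (\<lambda>x. indicator {s<..<t} x * ((x - s) powr ((1 + \<gamma>) - 1) * (t - x) powr ((1 - \<gamma>) - 1)))
    (Beta (1 + \<gamma>) (1 - \<gamma>) * (t - s) powr ((1 + \<gamma>) + (1 - \<gamma>) - 1))"
    using assms True by (intro has_bochner_integral_Beta) auto
  also have "?this \<longleftrightarrow> has_bochner_integral lborel
      (\<lambda>x. indicator {0..t} x * ((max 0 (x - s)) powr \<gamma> / (t - x) powr \<gamma>))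
      (Beta (1 + \<gamma>) (1 - \<gamma>) * (t - s) powr ((1 + \<gamma>) + (1 - \<gamma>) - 1))"
    using s by (intro has_bochner_integral_cong_AE)
       (auto intro!: eventually_mono[OF AE_lborel_singleton[of t]]
         simp: indicator_def powr_minus_divide max_def)
  \<comment> \<open>\<open>Gamma 2 = 1\<close> is the denominator of the Beta function here.\<close>
  also have "Beta (1 + \<gamma>) (1 - \<gamma>) = Gamma (1 + \<gamma>) * Gamma (1 - \<gamma>)"
    using Gamma_numeral[of "num.Bit0 num.One", where ?'a = real] by (simp add: Beta_def)
  finally show ?thesis using True by simp
next
  case False
  have "indicator {0..t} x * ((max 0 (x - s)) powr \<gamma> / (t - x) powr \<gamma>) = 0" for x
    using False by (cases "x \<le> t") auto
  hence "(\<lambda>x. indicator {0..t} x * ((max 0 (x - s)) powr \<gamma> / (t - x) powr \<gamma>)) = (\<lambda>x. 0)"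
    by blast
  thus ?thesis using False has_bochner_integral_zero by simp
qed

lemma abel_powr:
  assumes "0 < \<gamma>" "\<gamma> < 1" "0 < t"
  shows "abel_integral \<gamma> (\<lambda>s. s powr \<gamma>) t = Gamma (1 + \<gamma>) * Gamma (1 - \<gamma>) * t"
proof -
  have "abel_integral \<gamma> (\<lambda>s. s powr \<gamma>) t =
      (\<integral>x. indicator {0..t} x * ((max 0 (x - 0)) powr \<gamma> / (t - x) powr \<gamma>) \<partial>lborel)"
    unfolding abel_integral_def set_lebesgue_integral_def
    by (intro Bochner_Integration.integral_cong) (auto simp: indicator_def)
  also have "\<dots> = Gamma (1 + \<gamma>) * Gamma (1 - \<gamma>) * max 0 (t - 0)"
    using assms by (intro has_bochner_integral_integral_eq abel_shifted_powr) auto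
  finally show ?thesis using assms by simp
qed

text \<open>In its first argument the kernel is a combination of two truncated powers, with shifts
  \<open>0\<close> and \<open>s\<close>; each has a linear Abel integral.\<close>

lemma abel_green_kernel:
  assumes \<gamma>: "0 < \<gamma>" "\<gamma> < 1" and s: "0 \<le> s" "s \<le> 1" and t: "0 < t"
  shows "has_bochner_integral lborel
    (\<lambda>x. indicator {0..t} x * (green_kernel \<gamma> x s / (t - x) powr \<gamma>))
    (Gamma (1 + \<gamma>) * Gamma (1 - \<gamma>) * ((1 - s) powr \<gamma> * t - max 0 (t - s)))"
proof -
  let ?F = "\<lambda>s x. indicator {0..t} x * ((max 0 (x - s)) powr \<gamma> / (t - x) powr \<gamma>)"
  let ?C = "Gamma (1 + \<gamma>) * Gamma (1 - \<gamma>)"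
  have "has_bochner_integral lborel (\<lambda>x. (1 - s) powr \<gamma> * ?F 0 x) ((1 - s) powr \<gamma> * (?C * max 0 (t - 0)))"
    by (rule has_bochner_integral_mult_right[where f = "?F 0"]) (rule abel_shifted_powr[OF \<gamma> order_refl t])
  from has_bochner_integral_diff[OF this abel_shifted_powr[OF \<gamma> s(1) t]]
  have "has_bochner_integral lborel (\<lambda>x. (1 - s) powr \<gamma> * ?F 0 x - ?F s x)
     ((1 - s) powr \<gamma> * (?C * max 0 (t - 0)) - ?C * max 0 (t - s))" .
  moreover have "indicator {0..t} x * (green_kernel \<gamma> x s / (t - x) powr \<gamma>) =
      (1 - s) powr \<gamma> * (indicator {0..t} x * ((max 0 (x - 0)) powr \<gamma> / (t - x) powr \<gamma>)) -
        indicator {0..t} x * ((max 0 (x - s)) powr \<gamma> / (t - x) powr \<gamma>)" for x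
    using powr_mult[of x "1 - s" \<gamma>] s
    by (cases "x \<in> {0..t}") (simp_all add: green_kernel_def diff_divide_distrib)
  moreover have "(1 - s) powr \<gamma> * (Gamma (1 + \<gamma>) * Gamma (1 - \<gamma>) * max 0 (t - 0)) -
        Gamma (1 + \<gamma>) * Gamma (1 - \<gamma>) * max 0 (t - s) =
      Gamma (1 + \<gamma>) * Gamma (1 - \<gamma>) * ((1 - s) powr \<gamma> * t - max 0 (t - s))"
    using t by (simp add: algebra_simps)
  ultimately show ?thesis by (simp only:)
qed

text \<open>
  Integrating the Abel integral once more against \<open>(x - t) powr (\<gamma> - 1)\<close> and exchanging the order of
  integration leaves a constant Beta value as kernel, so that all integrals of \<open>u\<close> vanish.
\<close>

lemma abel_integral_eq_0_imp_eq_0: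
  fixes u :: "real \<Rightarrow> real"
  assumes \<gamma>: "0 < \<gamma>" "\<gamma> < 1" and u: "continuous_on {0..1} u"
    and zero: "\<And>t. t \<in> {0<..<1} \<Longrightarrow> abel_integral \<gamma> u t = 0"
    and x: "x \<in> {0<..<1}"
  shows "u x = 0"
proof -
  have int0: "integral {0..x} u = 0" if x: "x \<in> {0<..<1}" for x
  proof -
    define v where "v = (\<lambda>s. indicator {0<..<x} s * u s)"
    have vm [measurable]: "v \<in> borel_measurable borel"
    proof -
      have "continuous_on {0<..<x} u" using x by (intro continuous_on_subset[OF u]) auto
      from borel_measurable_continuous_on_indicator[OF _ this] show ?thesis by (simp add: v_def)
    qed
    obtain M where M: "\<And>s. s \<in> {0..1} \<Longrightarrow> \<bar>u s\<bar> \<le> M"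
      using compact_imp_bounded[OF compact_continuous_image[OF u]]
    unfolding bounded_iff by (metis compact_Icc imageI real_norm_def)
    have vint: "integrable lborel v"
    proof (rule Bochner_Integration.integrable_bound)
      show "integrable lborel (\<lambda>s. indicator {0<..<x} s * M)"
        using x by (intro integrable_mult_left) (auto simp: integrable_indicator_iff)
      show "AE s in lborel. norm (v s) \<le> norm (indicator {0<..<x} s * M)"
        using M x by (intro AE_I2) (force simp: v_def indicator_def intro: order_trans[OF _ abs_ge_self])
    qed auto
    \<comment> \<open>The exponents sum to \<open>-1\<close>, so the integral of \<open>k s\<close>
      over \<open>(s, x)\<close> is independent of the length of the interval. For
      \<open>s \<ge> x\<close> the factor \<open>v s\<close> vanishes.\<close>
    define k where "k = (\<lambda>s t. indicator {s<..<x} t * ((t - s) powr ((1 - \<gamma>) - 1) * (x - t) powr (\<gamma> - 1)))"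
    have k: "has_bochner_integral lborel (k s) (Beta (1 - \<gamma>) \<gamma>)" if "s < x" for s
      using has_bochner_integral_Beta[of "1 - \<gamma>" \<gamma> s x] \<gamma> that by (simp add: k_def)
    have k0: "0 \<le> k s t" for s t by (simp add: k_def)
    have vk: "has_bochner_integral lborel (\<lambda>t. v s * k s t) (v s * Beta (1 - \<gamma>) \<gamma>)" for s
      using k[of s] by (cases "s < x") (auto simp: v_def)
    have vk': "has_bochner_integral lborel (\<lambda>t. \<bar>v s * k s t\<bar>) (\<bar>v s\<bar> * Beta (1 - \<gamma>) \<gamma>)" for s
      using k[of s] k0 by (cases "s < x") (auto simp: v_def abs_mult)
    have "(\<integral>t. (\<integral>s. v s * k s t \<partial>lborel) \<partial>lborel) = (\<integral>s. (\<integral>t. v s * k s t \<partial>lborel) \<partial>lborel)"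
    proof (rule integral_swap_lborel)
      show "(\<lambda>(s, t). v s * k s t) \<in> borel_measurable (lborel \<Otimes>\<^sub>M lborel)"
        unfolding k_def indicator_def by (simp add: case_prod_beta') measurable
      show "integrable lborel (\<lambda>t. v s * k s t)" for s using vk by (rule integrable.intros)
      show "integrable lborel (\<lambda>s. \<integral>t. \<bar>v s * k s t\<bar> \<partial>lborel)"
        using vint by (simp add: has_bochner_integral_integral_eq[OF vk'])
    qed
    also have "\<dots> = (\<integral>s. v s \<partial>lborel) * Beta (1 - \<gamma>) \<gamma>"
      unfolding has_bochner_integral_integral_eq[OF vk] by simp
    finally have eq: "(\<integral>t. (\<integral>s. v s * k s t \<partial>lborel) \<partial>lborel) = (\<integral>s. v s \<partial>lborel) * Beta (1 - \<gamma>) \<gamma>" .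
    have "(\<integral>s. v s * k s t \<partial>lborel) = 0" for t
    proof (cases "t \<in> {0<..<x}")
      case True
      \<comment> \<open>For \<open>t\<close> below \<open>x\<close> the indicator in
        \<open>k\<close> restricts \<open>v\<close> to \<open>s < t\<close>, so the inner integral
        is a multiple of the Abel integral of \<open>u\<close> at \<open>t\<close>, which is zero by
        hypothesis.\<close>
      have "(\<integral>s. v s * k s t \<partial>lborel) =
          (\<integral>s. (x - t) powr (\<gamma> - 1) * (indicator {0..t} s * (u s / (t - s) powr \<gamma>)) \<partial>lborel)"
        using True
      proof (intro integral_cong_AE)
        show "AE s in lborel. v s * k s t =
            (x - t) powr (\<gamma> - 1) * (indicator {0..t} s * (u s / (t - s) powr \<gamma>))"
          using AE_lborel_singleton[of 0] AE_lborel_singleton[of t]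
          by eventually_elim (use True in \<open>auto simp: v_def k_def indicator_def powr_minus_divide\<close>)
        have "set_integrable lborel {0..t} (\<lambda>s. u s / (t - s) powr \<gamma>)"
          using abel_integrable(1)[OF \<gamma>(2) _ _ u, of t] True x by auto
        hence "(\<lambda>s. indicator {0..t} s * (u s / (t - s) powr \<gamma>)) \<in> borel_measurable lborel"
          by (auto simp: set_integrable_def)
        thus "(\<lambda>s. (x - t) powr (\<gamma> - 1) * (indicator {0..t} s * (u s / (t - s) powr \<gamma>)))
            \<in> borel_measurable lborel" by measurable
      qed (simp add: k_def indicator_def)
      also have "\<dots> = (x - t) powr (\<gamma> - 1) * abel_integral \<gamma> u t"
        unfolding abel_integral_def set_lebesgue_integral_def real_scaleR_def
        by (rule integral_mult_right_zero)
      finally show ?thesis using zero[of t] True x by auto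
    next
      case False
      hence "(\<lambda>s. v s * k s t) = (\<lambda>s. 0)" by (auto simp: v_def k_def fun_eq_iff indicator_def)
      thus ?thesis by simp
    qed
    moreover have "0 < Beta (1 - \<gamma>) \<gamma>" using \<gamma> by (simp add: Beta_def)
    ultimately have "(\<integral>s. v s \<partial>lborel) = 0" using eq by simp
    moreover have "(\<integral>s. v s \<partial>lborel) = integral {0<..<x} u"
      using set_borel_integral_eq_integral(2)[of "{0<..<x}" u] vint
      by (simp add: set_integrable_def set_lebesgue_integral_def v_def)
    ultimately show ?thesis by (simp add: integral_open_interval_real)
  qed
  have "((\<lambda>x. integral {0..x} u) has_real_derivative u x) (at x)"
  proof -
    have "((\<lambda>x. integral {0..x} u) has_real_derivative u x) (at x within {0..1})"
      using x u by (intro integral_has_real_derivative) auto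
    thus ?thesis using x by (simp add: at_within_Icc_at)
  qed
  moreover have "((\<lambda>x. integral {0..x} u) has_real_derivative 0) (at x)"
  proof -
    have "\<forall>\<^sub>F y in nhds x. y \<in> {0<..<1}" using x by (intro eventually_nhds_in_open) auto
    hence "\<forall>\<^sub>F y in nhds x. integral {0..y} u = 0" by eventually_elim (rule int0)
    thus ?thesis by (subst DERIV_cong_ev[OF refl _ refl, where g = "\<lambda>_. 0"]) auto
  qed
  ultimately show ?thesis by (rule DERIV_unique)
qed

section \<open>Absolute continuity and one-dimensional calculus\<close>

lemma abs_cont_on_imp_continuous_on:
  assumes "abs_cont_on c d f"
  shows "continuous_on {c..d} f"
  unfolding continuous_on_iff
proof (intro ballI allI impI)
  fix x e :: real assume x: "x \<in> {c..d}" and "0 < e"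
  then obtain \<delta> where \<delta>: "\<delta> > 0" and *: "\<And>(n::nat) a b.
      (\<forall>i<n. c \<le> a i \<and> a i \<le> b i \<and> b i \<le> d) \<Longrightarrow>
      disjoint_family_on (\<lambda>i. {a i<..<b i}) {..<n} \<Longrightarrow>
      (\<Sum>i<n. b i - a i) < \<delta> \<Longrightarrow> (\<Sum>i<n. \<bar>f (b i) - f (a i)\<bar>) < e"
    using assms unfolding abs_cont_on_def by meson
  have "dist (f y) (f x) < e" if y: "y \<in> {c..d}" "dist y x < \<delta>" for y
    using *[of 1 "\<lambda>_. min x y" "\<lambda>_. max x y"] x y
    by (cases "x \<le> y") (auto simp: disjoint_family_on_def dist_real_def abs_minus_commute)
  thus "\<exists>\<delta>>0. \<forall>y\<in>{c..d}. dist y x < \<delta> \<longrightarrow> dist (f y) (f x) < e" using \<delta> by blast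
qed

lemma lipschitz_imp_abs_cont_on:
  assumes "\<And>x y. c \<le> x \<Longrightarrow> x \<le> y \<Longrightarrow> y \<le> d \<Longrightarrow> \<bar>f y - f x\<bar> \<le> B * (y - x)"
  shows "abs_cont_on c d f"
  unfolding abs_cont_on_def
proof (intro allI impI)
  fix \<epsilon> :: real assume "0 < \<epsilon>"
  \<comment> \<open>The sign of \<open>B\<close> is unknown; \<open>C\<close> is a strictly positive
    Lipschitz constant by which \<open>\<epsilon>\<close> can be divided.\<close>
  define C where "C = \<bar>B\<bar> + 1"
  have C: "0 < C" "B \<le> C" by (auto simp: C_def)
  have "(\<Sum>i<n. \<bar>f (b i) - f (a i)\<bar>) < \<epsilon>"
    if ab: "\<forall>i<n. c \<le> a i \<and> a i \<le> b i \<and> b i \<le> d" and l: "(\<Sum>i<n. b i - a i) < \<epsilon> / C"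
    for n :: nat and a b
  proof -
    have "(\<Sum>i<n. \<bar>f (b i) - f (a i)\<bar>) \<le> (\<Sum>i<n. C * (b i - a i))"
    proof (rule sum_mono)
      fix i assume i: "i \<in> {..<n}"
      hence "B * (b i - a i) \<le> C * (b i - a i)" using ab C by (intro mult_right_mono) auto
      thus "\<bar>f (b i) - f (a i)\<bar> \<le> C * (b i - a i)" using assms[of "a i" "b i"] ab i by force
    qed
    also have "\<dots> = (\<Sum>i<n. b i - a i) * C" by (simp add: sum_distrib_left mult.commute)
    also have "\<dots> < \<epsilon>" using l C by (simp add: pos_less_divide_eq)
    finally show ?thesis .
  qed
  thus "\<exists>\<delta>>0. \<forall>(n::nat) a b.
      (\<forall>i<n. c \<le> a i \<and> a i \<le> b i \<and> b i \<le> d) \<and>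
      disjoint_family_on (\<lambda>i. {a i<..<b i}) {..<n} \<and> (\<Sum>i<n. b i - a i) < \<delta> \<longrightarrow>
      (\<Sum>i<n. \<bar>f (b i) - f (a i)\<bar>) < \<epsilon>"
    using C \<open>0 < \<epsilon>\<close> by (intro exI[of _ "\<epsilon> / C"]) auto
qed

lemma DERIV_cong_Ioo:
  fixes f h :: "real \<Rightarrow> real"
  assumes "(h has_real_derivative d) (at t)" "t \<in> {a<..<b}" "\<And>s. s \<in> {a<..<b} \<Longrightarrow> f s = h s"
  shows "(f has_real_derivative d) (at t)"
  using assms by (intro has_field_derivative_transform_within_open[OF assms(1), of "{a<..<b}"]) auto

lemma DERIV_eq_on_Ioo_imp_const:
  fixes f h :: "real \<Rightarrow> real"
  assumes "\<And>t. t \<in> {a<..<b} \<Longrightarrow> (f has_real_derivative d t) (at t)"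
    and "\<And>t. t \<in> {a<..<b} \<Longrightarrow> (h has_real_derivative d t) (at t)"
  obtains k where "\<And>t. t \<in> {a<..<b} \<Longrightarrow> f t = h t + k"
proof -
  have "\<exists>k. \<forall>t\<in>{a<..<b}. f t - h t = k"
  proof (rule has_field_derivative_zero_constant)
    fix t assume "t \<in> {a<..<b}"
    hence "((\<lambda>t. f t - h t) has_real_derivative d t - d t) (at t)"
      using assms by (intro DERIV_diff)
    thus "((\<lambda>t. f t - h t) has_real_derivative 0) (at t within {a<..<b})"
      by (simp add: has_field_derivative_at_within)
  qed auto
  then obtain k where "\<And>t. t \<in> {a<..<b} \<Longrightarrow> f t - h t = k" by blast
  thus ?thesis by (intro that[of k]) (simp add: algebra_simps)
qed

lemma continuous_on_const_closed_interval:
  fixes f :: "real \<Rightarrow> real"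
  assumes "continuous_on {0..1} f" "\<And>t. t \<in> {0<..<1} \<Longrightarrow> f t = c" "t \<in> {0..1}"
  shows "f t = c"
  using continuous_constant_on_closure[of "{0<..<1}" f c t] assms by simp

text \<open>\<open>f\<close> may be singular at \<open>0\<close>, so the fundamental theorem is
  applied from the base point \<open>t / 2\<close>, where continuity on a compact interval is
  available.\<close>

lemma integral_upper_DERIV:
  fixes f :: "real \<Rightarrow> real"
  assumes f: "continuous_on {0<..1} f" and t: "t \<in> {0<..<1}"
  shows "((\<lambda>t. integral {t..1} f) has_real_derivative - f t) (at t)"
proof -
  define c where "c = t / 2"
  have c: "0 < c" "c < t" using t by (auto simp: c_def)
  have fc: "continuous_on {c..1} f" using c by (intro continuous_on_subset[OF f]) auto
  have "((\<lambda>t. integral {c..t} f) has_real_derivative f t) (at t within {c..1})"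
    using fc c t by (intro integral_has_real_derivative) auto
  hence "((\<lambda>t. integral {c..t} f) has_real_derivative f t) (at t)"
    using c t by (simp add: at_within_Icc_at)
  hence "((\<lambda>t. integral {c..1} f - integral {c..t} f) has_real_derivative - f t) (at t)"
    by (auto intro!: derivative_eq_intros)
  thus ?thesis
  proof (rule DERIV_cong_Ioo)
    show "t \<in> {c<..<1}" using c t by auto
    show "integral {s..1} f = integral {c..1} f - integral {c..s} f" if "s \<in> {c<..<1}" for s
      using Henstock_Kurzweil_Integration.integral_combine[where a = c and c = s and b = 1 and f = f] that integrable_continuous_real[OF fc] by auto
  qed
qed

lemma integral_upper_continuous:
  fixes f :: "real \<Rightarrow> real"
  assumes f: "continuous_on {0<..1} f"
  shows "continuous_on {0<..1} (\<lambda>t. integral {t..1} f)"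
proof -
  have "continuous (at t within {0<..1}) (\<lambda>t. integral {t..1} f)" if t: "t \<in> {0<..1}" for t
  proof -
    define c where "c = t / 2"
    have c: "0 < c" "c < t" using t by (auto simp: c_def)
    have "f integrable_on {c..1}" using c
      by (intro integrable_continuous_real continuous_on_subset[OF f]) auto
    from indefinite_integral_continuous_1'[OF this] have "continuous_on {c..1} (\<lambda>t. integral {t..1} f)" .
    hence "continuous (at t within {c..1}) (\<lambda>t. integral {t..1} f)"
      using t c by (auto simp: continuous_on_eq_continuous_within)
    moreover have "at t within {c..1} = at t within {0<..1}"
      using t c by (intro at_within_nhd[of _ "{c<..}"]) auto
    ultimately show ?thesis by simp
  qed
  thus ?thesis by (simp add: continuous_on_eq_continuous_within)
qed

lemma abs_cont_on_cong:
  assumes "abs_cont_on c d f" "\<And>t. t \<in> {c..d} \<Longrightarrow> h t = f t"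
  shows "abs_cont_on c d h"
  unfolding abs_cont_on_def
proof (intro allI impI)
  fix \<epsilon> :: real assume "0 < \<epsilon>"
  then obtain \<delta> where \<delta>: "\<delta> > 0" and *: "\<And>(n::nat) a b.
      (\<forall>i<n. c \<le> a i \<and> a i \<le> b i \<and> b i \<le> d) \<and>
      disjoint_family_on (\<lambda>i. {a i<..<b i}) {..<n} \<and>
      (\<Sum>i<n. b i - a i) < \<delta> \<Longrightarrow> (\<Sum>i<n. \<bar>f (b i) - f (a i)\<bar>) < \<epsilon>"
    using assms(1) unfolding abs_cont_on_def by meson
  have "(\<Sum>i<n. \<bar>h (b i) - h (a i)\<bar>) < \<epsilon>"
    if ab: "(\<forall>i<n. c \<le> a i \<and> a i \<le> b i \<and> b i \<le> d) \<and>
      disjoint_family_on (\<lambda>i. {a i<..<b i}) {..<n} \<and> (\<Sum>i<n. b i - a i) < \<delta>" for n :: nat and a b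
  proof -
    have "h (a i) = f (a i)" "h (b i) = f (b i)" if "i < n" for i
      using assms(2)[of "a i"] assms(2)[of "b i"] ab that by force+
    thus ?thesis using *[OF ab] by simp
  qed
  thus "\<exists>\<delta>>0. \<forall>(n::nat) a b.
      (\<forall>i<n. c \<le> a i \<and> a i \<le> b i \<and> b i \<le> d) \<and>
      disjoint_family_on (\<lambda>i. {a i<..<b i}) {..<n} \<and> (\<Sum>i<n. b i - a i) < \<delta> \<longrightarrow>
      (\<Sum>i<n. \<bar>h (b i) - h (a i)\<bar>) < \<epsilon>"
    using \<delta> by blast
qed

lemma abs_cont_on_cdivide:
  assumes "abs_cont_on c d f" and k: "0 < k"
  shows "abs_cont_on c d (\<lambda>t. f t / k)"
  unfolding abs_cont_on_def
proof (intro allI impI)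
  fix \<epsilon> :: real assume "0 < \<epsilon>"
  hence "0 < \<epsilon> * k" using k by simp
  then obtain \<delta> where \<delta>: "\<delta> > 0" and *: "\<And>(n::nat) a b.
      (\<forall>i<n. c \<le> a i \<and> a i \<le> b i \<and> b i \<le> d) \<and>
      disjoint_family_on (\<lambda>i. {a i<..<b i}) {..<n} \<and>
      (\<Sum>i<n. b i - a i) < \<delta> \<Longrightarrow> (\<Sum>i<n. \<bar>f (b i) - f (a i)\<bar>) < \<epsilon> * k"
    using assms(1) unfolding abs_cont_on_def by meson
  have "(\<Sum>i<n. \<bar>f (b i) / k - f (a i) / k\<bar>) = (\<Sum>i<n. \<bar>f (b i) - f (a i)\<bar>) / k" for n :: nat and a b
    using k by (simp add: sum_divide_distrib flip: diff_divide_distrib)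
  thus "\<exists>\<delta>>0. \<forall>(n::nat) a b.
      (\<forall>i<n. c \<le> a i \<and> a i \<le> b i \<and> b i \<le> d) \<and>
      disjoint_family_on (\<lambda>i. {a i<..<b i}) {..<n} \<and> (\<Sum>i<n. b i - a i) < \<delta> \<longrightarrow>
      (\<Sum>i<n. \<bar>f (b i) / k - f (a i) / k\<bar>) < \<epsilon>"
    using \<delta> * k by (intro exI[of _ \<delta>]) (simp add: pos_divide_less_eq)
qed

lemma LINT_upper_eq_integral:
  fixes f :: "real \<Rightarrow> real"
  assumes f: "continuous_on {0<..1} f" and t: "t \<in> {0<..1}"
  shows "(\<integral>s. indicator {t..1} s * f s \<partial>lborel) = integral {t..1} f"
proof -
  have "set_integrable lborel {t..1} f"
    using t by (intro borel_integrable_atLeastAtMost' continuous_on_subset[OF f]) auto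
  from set_borel_integral_eq_integral(2)[OF this] show ?thesis
    by (simp add: set_lebesgue_integral_def)
qed

section \<open>Riemann--Liouville operators of order at most two\<close>

lemma RL_order_add_1: "0 < \<beta> \<Longrightarrow> RL_order (\<beta> + 1) = Suc (RL_order \<beta>)"
  by (simp add: RL_order_def nat_add_distrib)

text \<open>Raising the order by one raises \<open>RL_order\<close> by one and leaves the kernel
  exponent \<open>\<beta> - n + 1\<close> unchanged. The derivative of order
  \<open>\<beta> + 1\<close> thus differentiates the same integral once more.\<close>

lemma RL_integral_add_1: "0 < \<beta> \<Longrightarrow> RL_integral (\<beta> + 1) u = RL_integral \<beta> u"
  by (simp add: RL_integral_def RL_order_add_1 fun_eq_iff)

lemma RL_order_eq_1: "0 < \<beta> \<Longrightarrow> \<beta> < 1 \<Longrightarrow> RL_order \<beta> = 1"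
  by (simp add: RL_order_def floor_eq_iff)

lemma RL_integral_eq_abel: "0 < \<beta> \<Longrightarrow> \<beta> < 1 \<Longrightarrow> RL_integral \<beta> u = abel_integral \<beta> u"
  by (simp add: RL_integral_def abel_integral_def RL_order_eq_1 fun_eq_iff)

lemma RL_order_1: "RL_order 1 = 2"
  by (simp add: RL_order_def)

text \<open>At order \<open>1\<close> the kernel exponent is \<open>0\<close>. Since
  \<open>0 powr 0 = 0\<close>, the integrand at \<open>s = t\<close> is \<open>0\<close> instead of
  \<open>u t\<close>, so it agrees with \<open>u\<close> only almost everywhere.\<close>

lemma RL_1_integrable:
  assumes "continuous_on {0..1} u" "t \<in> {0..1}"
  shows "set_integrable lborel {0..t} (\<lambda>s. u s / (t - s) powr 0)"
    and "RL_integral 1 u t = integral {0..t} u"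
proof -
  have i: "set_integrable lborel {0..t} u"
    using assms by (intro borel_integrable_atLeastAtMost' continuous_on_subset[OF assms(1)]) auto
  have AE: "AE s in lborel. indicator {0..t} s *\<^sub>R (u s / (t - s) powr 0) = indicator {0..t} s *\<^sub>R u s"
    using AE_lborel_singleton[of t] by eventually_elim simp
  have [measurable]: "(\<lambda>s. indicator {0..t} s * u s) \<in> borel_measurable lborel"
    using i by (auto simp: set_integrable_def)
  have "(\<lambda>s. (indicator {0..t} s * u s) / (t - s) powr 0) \<in> borel_measurable lborel"
    by measurable
  hence m: "(\<lambda>s. indicator {0..t} s *\<^sub>R (u s / (t - s) powr 0)) \<in> borel_measurable lborel" by simp
  show "set_integrable lborel {0..t} (\<lambda>s. u s / (t - s) powr 0)"
    using i integrable_cong_AE[OF m _ AE] unfolding set_integrable_def by simp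
  have "RL_integral 1 u t = (LINT s:{0..t}|lborel. u s / (t - s) powr 0)"
    by (simp add: RL_integral_def RL_order_1)
  also have "\<dots> = (LINT s:{0..t}|lborel. u s)"
    unfolding set_lebesgue_integral_def using AE m by (intro integral_cong_AE) auto
  finally show "RL_integral 1 u t = integral {0..t} u"
    using set_borel_integral_eq_integral(2)[OF i] by simp
qed

lemma integral_lower_DERIV:
  fixes u :: "real \<Rightarrow> real"
  assumes "continuous_on {0..1} u" "t \<in> {0<..<1}"
  shows "((\<lambda>t. integral {0..t} u) has_real_derivative u t) (at t)"
proof -
  have "((\<lambda>t. integral {0..t} u) has_real_derivative u t) (at t within {0..1})"
    using assms by (intro integral_has_real_derivative) auto
  thus ?thesis using assms by (simp add: at_within_Icc_at)
qed

section \<open>The Green potential\<close>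

locale green_bvp =
  fixes \<gamma> :: real and g :: "real \<Rightarrow> real"
  assumes \<gamma>: "0 < \<gamma>" "\<gamma> \<le> 1"
    and g_cont: "continuous_on {0<..1} g"
    and g_nonneg: "\<And>s. s \<in> {0<..1} \<Longrightarrow> 0 \<le> g s"
    and g_int: "set_integrable lborel {0<..1} (\<lambda>s. s powr \<gamma> * g s)"
begin

text \<open>Extending \<open>g\<close> by \<open>0\<close> discards the meaningless value \<open>g 0\<close>.\<close>

definition \<phi> :: "real \<Rightarrow> real" where
  "\<phi> s = indicator {0<..1} s * g s"

lemma \<phi>_measurable [measurable]: "\<phi> \<in> borel_measurable borel"
  using borel_measurable_continuous_on_indicator[OF _ g_cont] by (simp add: \<phi>_def[abs_def])

lemma \<phi>_nonneg: "0 \<le> \<phi> s"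
  using g_nonneg by (simp add: \<phi>_def indicator_def)

lemma \<phi>_eq_0: "s \<notin> {0<..1} \<Longrightarrow> \<phi> s = 0"
  by (simp add: \<phi>_def)

lemma \<phi>_eq: "s \<in> {0<..1} \<Longrightarrow> \<phi> s = g s"
  by (simp add: \<phi>_def)

text \<open>This reduces integrability against \<open>\<phi>\<close> to a pointwise comparison with
  the weight \<open>s powr \<gamma>\<close>.\<close>

lemma integrable_mult_\<phi>:
  assumes [measurable]: "k \<in> borel_measurable borel"
    and k: "\<And>s. s \<in> {0<..1} \<Longrightarrow> \<bar>k s\<bar> \<le> C * s powr \<gamma>"
  shows "integrable lborel (\<lambda>s. k s * \<phi> s)"
proof (rule Bochner_Integration.integrable_bound)
  show "integrable lborel (\<lambda>s. C * (s powr \<gamma> * \<phi> s))"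
    using g_int by (intro integrable_mult_right) (simp add: set_integrable_def \<phi>_def mult.left_commute)
  show "AE s in lborel. norm (k s * \<phi> s) \<le> norm (C * (s powr \<gamma> * \<phi> s))"
  proof (rule AE_I2)
    fix s
    show "norm (k s * \<phi> s) \<le> norm (C * (s powr \<gamma> * \<phi> s))"
    proof (cases "s \<in> {0<..1}")
      case True
      hence "\<bar>k s\<bar> * \<phi> s \<le> C * s powr \<gamma> * \<phi> s" using k \<phi>_nonneg by (intro mult_right_mono)
      also have "\<dots> \<le> \<bar>C * (s powr \<gamma> * \<phi> s)\<bar>" by (simp add: mult.assoc)
      finally show ?thesis using \<phi>_nonneg[of s] by (simp add: abs_mult)
    qed (simp add: \<phi>_eq_0)
  qed
qed measurable

lemma integrable_min_powr: "0 < \<delta> \<Longrightarrow> integrable lborel (\<lambda>s. (min s \<delta>) powr \<gamma> * \<phi> s)"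
  using \<gamma> by (intro integrable_mult_\<phi>[where C = 1]) (auto intro: powr_mono2)

text \<open>Dominated convergence along \<open>\<delta> = 1 / (n + 1)\<close> with majorant
  \<open>s powr \<gamma> * \<phi> s\<close>. It serves both the absolute continuity of
  \<open>V\<close> and the continuity of \<open>t powr \<gamma> * w t\<close> at
  \<open>0\<close>.\<close>

lemma small_min_integral:
  assumes "0 < \<epsilon>"
  obtains \<delta> where "0 < \<delta>" "(\<integral>s. (min s \<delta>) powr \<gamma> * \<phi> s \<partial>lborel) < \<epsilon>"
proof -
  have "(\<lambda>n. \<integral>s. (min s (1 / Suc n)) powr \<gamma> * \<phi> s \<partial>lborel) \<longlonglongrightarrow> (\<integral>s. 0 \<partial>(lborel :: real measure))"
  proof (rule integral_dominated_convergence[where w = "\<lambda>s. s powr \<gamma> * \<phi> s"])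
    show "integrable lborel (\<lambda>s. s powr \<gamma> * \<phi> s)"
      by (intro integrable_mult_\<phi>[where C = 1]) auto
    show "AE s in lborel. (\<lambda>n. (min s (1 / Suc n)) powr \<gamma> * \<phi> s) \<longlonglongrightarrow> 0"
    proof (rule AE_I2)
      fix s
      show "(\<lambda>n. (min s (1 / Suc n)) powr \<gamma> * \<phi> s) \<longlonglongrightarrow> 0"
      proof (cases "s \<in> {0<..1}")
        case True
        have "(\<lambda>n. min s (1 / Suc n)) \<longlonglongrightarrow> min s 0"
          by (intro tendsto_min tendsto_const LIMSEQ_Suc lim_1_over_n)
        hence "(\<lambda>n. (min s (1 / Suc n)) powr \<gamma>) \<longlonglongrightarrow> 0 powr \<gamma>"
          using True \<gamma> by (intro tendsto_powr') auto
        thus ?thesis using \<gamma> tendsto_mult_right[of _ "0 powr \<gamma>" _ "\<phi> s"] by simp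
      qed (simp add: \<phi>_eq_0)
    qed
    show "AE s in lborel. norm ((min s (1 / Suc n)) powr \<gamma> * \<phi> s) \<le> s powr \<gamma> * \<phi> s" for n
    proof (rule AE_I2)
      fix s
      show "norm ((min s (1 / Suc n)) powr \<gamma> * \<phi> s) \<le> s powr \<gamma> * \<phi> s"
      proof (cases "s \<in> {0<..1}")
        case True
        hence "(min s (1 / Suc n)) powr \<gamma> \<le> s powr \<gamma>" using \<gamma> by (intro powr_mono2) auto
        thus ?thesis using \<phi>_nonneg[of s] by (simp add: abs_mult mult_right_mono)
      qed (simp add: \<phi>_eq_0)
    qed
  qed measurable
  hence "\<forall>\<^sub>F n in sequentially. (\<integral>s. (min s (1 / Suc n)) powr \<gamma> * \<phi> s \<partial>lborel) < \<epsilon>"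
    using assms by (intro order_tendstoD(2)) auto
  then obtain n where "(\<integral>s. (min s (1 / Suc n)) powr \<gamma> * \<phi> s \<partial>lborel) < \<epsilon>"
    by (auto simp: eventually_sequentially)
  thus ?thesis by (intro that[of "1 / Suc n"]) auto
qed

text \<open>On \<open>[0,1]\<close> this is \<open>Gamma (1 + \<gamma>)\<close> times the Green
  potential.\<close>

definition V :: "real \<Rightarrow> real" where
  "V t = (\<integral>s. green_kernel \<gamma> t s * \<phi> s \<partial>lborel)"

lemma green_kernel_measurable [measurable]:
  "(\<lambda>s. green_kernel \<gamma> t s) \<in> borel_measurable borel"
  unfolding green_kernel_def by measurable

lemma V_integrable:
  "t \<in> {0..1} \<Longrightarrow> integrable lborel (\<lambda>s. green_kernel \<gamma> t s * \<phi> s)"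
  using green_kernel_bounds[OF \<gamma>, of _ t] by (intro integrable_mult_\<phi>[where C = 1]) auto

lemma Green_set_integrable_and_eq:
  assumes t: "t \<in> {0..1}"
  shows "set_integrable lborel {0..1} (\<lambda>s. Green (\<gamma> + 1) t s * g s)"
    and "Green_op (\<gamma> + 1) g t = V t / Gamma (1 + \<gamma>)"
proof -
  have "indicator {0..1} s *\<^sub>R (Green (\<gamma> + 1) t s * g s) =
      (green_kernel \<gamma> t s * \<phi> s) / Gamma (1 + \<gamma>)" for s
  proof (cases "s = 0")
    \<comment> \<open>At \<open>s = 0\<close> the two powers in the kernel cancel, so the arbitrary
      value \<open>g 0\<close> is harmless.\<close>
    case True
    thus ?thesis using t by (simp add: Green_eq \<phi>_def green_kernel_def)
  qed (auto simp: Green_eq \<phi>_def indicator_def add.commute)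
  thus "set_integrable lborel {0..1} (\<lambda>s. Green (\<gamma> + 1) t s * g s)"
    "Green_op (\<gamma> + 1) g t = V t / Gamma (1 + \<gamma>)"
    using V_integrable[OF t]
    by (simp_all add: set_integrable_def Green_op_def set_lebesgue_integral_def V_def)
qed

lemma V_0: "V 0 = 0" and V_1: "V 1 = 0"
proof -
  have "green_kernel \<gamma> 0 s * \<phi> s = 0" "green_kernel \<gamma> 1 s * \<phi> s = 0" for s
    by (cases "s \<in> {0<..1}"; simp add: \<phi>_eq_0 green_kernel_def)+
  thus "V 0 = 0" "V 1 = 0" by (simp_all only: V_def Bochner_Integration.integral_zero)
qed

text \<open>The increments are summed under the integral sign, where the variation bound applies for
  each \<open>s\<close>. Its factor \<open>3\<close> explains the choice of \<open>\<delta>\<close>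
  for \<open>\<epsilon> / 3\<close>.\<close>

lemma V_abs_cont: "abs_cont_on 0 1 V"
  unfolding abs_cont_on_def
proof (intro allI impI)
  fix \<epsilon> :: real assume "0 < \<epsilon>"
  then obtain \<delta> where \<delta>: "0 < \<delta>" "(\<integral>s. (min s \<delta>) powr \<gamma> * \<phi> s \<partial>lborel) < \<epsilon> / 3"
    using small_min_integral[of "\<epsilon> / 3"] by auto
  have "(\<Sum>i<n. \<bar>V (b i) - V (a i)\<bar>) < \<epsilon>"
    if ab: "\<forall>i<n. 0 \<le> a i \<and> a i \<le> b i \<and> b i \<le> 1"
      and disj: "disjoint_family_on (\<lambda>i. {a i<..<b i}) {..<n}"
      and L: "(\<Sum>i<n. b i - a i) < \<delta>" for n :: nat and a b
  proof -
    let ?D = "\<lambda>i s. \<bar>green_kernel \<gamma> (b i) s - green_kernel \<gamma> (a i) s\<bar> * \<phi> s"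
    have V: "V (b i) - V (a i) = (\<integral>s. (green_kernel \<gamma> (b i) s - green_kernel \<gamma> (a i) s) * \<phi> s \<partial>lborel)"
      and int: "integrable lborel (\<lambda>s. (green_kernel \<gamma> (b i) s - green_kernel \<gamma> (a i) s) * \<phi> s)"
      if "i < n" for i
    proof -
      have "a i \<in> {0..1}" "b i \<in> {0..1}" using ab[rule_format, OF that] by auto
      thus "V (b i) - V (a i) = (\<integral>s. (green_kernel \<gamma> (b i) s - green_kernel \<gamma> (a i) s) * \<phi> s \<partial>lborel)"
        "integrable lborel (\<lambda>s. (green_kernel \<gamma> (b i) s - green_kernel \<gamma> (a i) s) * \<phi> s)"
        using V_integrable by (simp_all add: V_def left_diff_distrib)
    qed
    have D: "integrable lborel (?D i)" if "i < n" for i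
      using integrable_abs[OF int[OF that]] \<phi>_nonneg by (simp add: abs_mult)
    have "(\<Sum>i<n. \<bar>V (b i) - V (a i)\<bar>) \<le> (\<Sum>i<n. \<integral>s. ?D i s \<partial>lborel)"
    proof (rule sum_mono)
      fix i assume "i \<in> {..<n}"
      thus "\<bar>V (b i) - V (a i)\<bar> \<le> (\<integral>s. ?D i s \<partial>lborel)"
        using integral_abs_bound[of lborel "\<lambda>s. (green_kernel \<gamma> (b i) s - green_kernel \<gamma> (a i) s) * \<phi> s"]
          \<phi>_nonneg by (simp add: V abs_mult)
    qed
    also have "\<dots> = (\<integral>s. (\<Sum>i<n. ?D i s) \<partial>lborel)"
      using D by (intro Bochner_Integration.integral_sum[symmetric]) auto
    also have "\<dots> \<le> (\<integral>s. 3 * ((min s \<delta>) powr \<gamma> * \<phi> s) \<partial>lborel)"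
    proof (rule integral_mono)
      show "integrable lborel (\<lambda>s. \<Sum>i<n. ?D i s)" using D by (intro Bochner_Integration.integrable_sum) auto
      show "integrable lborel (\<lambda>s. 3 * ((min s \<delta>) powr \<gamma> * \<phi> s))"
        using integrable_min_powr[OF \<delta>(1)] by (intro integrable_mult_right) auto
      fix s
      show "(\<Sum>i<n. ?D i s) \<le> 3 * ((min s \<delta>) powr \<gamma> * \<phi> s)"
      proof (cases "s \<in> {0<..1}")
        case True
        have L0: "0 \<le> (\<Sum>i<n. b i - a i)" using ab by (intro sum_nonneg) auto
        have "(\<Sum>i<n. \<bar>green_kernel \<gamma> (b i) s - green_kernel \<gamma> (a i) s\<bar>)
            \<le> 3 * (min s (\<Sum>i<n. b i - a i)) powr \<gamma>"
          using True ab disj by (intro green_kernel_variation \<gamma>) auto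
        also have "\<dots> \<le> 3 * (min s \<delta>) powr \<gamma>"
          using L L0 True \<gamma> by (intro mult_left_mono powr_mono2) auto
        finally have "(\<Sum>i<n. \<bar>green_kernel \<gamma> (b i) s - green_kernel \<gamma> (a i) s\<bar>) * \<phi> s
            \<le> 3 * (min s \<delta>) powr \<gamma> * \<phi> s"
          using \<phi>_nonneg by (intro mult_right_mono)
        thus ?thesis by (simp add: sum_distrib_right mult.assoc)
      qed (simp add: \<phi>_eq_0)
    qed
    also have "\<dots> < \<epsilon>" using \<delta>(2) by simp
    finally show ?thesis .
  qed
  thus "\<exists>\<delta>>0. \<forall>(n::nat) a b.
      (\<forall>i<n. 0 \<le> a i \<and> a i \<le> b i \<and> b i \<le> 1) \<and>
      disjoint_family_on (\<lambda>i. {a i<..<b i}) {..<n} \<and> (\<Sum>i<n. b i - a i) < \<delta> \<longrightarrow>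
      (\<Sum>i<n. \<bar>V (b i) - V (a i)\<bar>) < \<epsilon>"
    using \<delta>(1) by blast
qed

lemma V_cont: "continuous_on {0..1} V"
  by (rule abs_cont_on_imp_continuous_on[OF V_abs_cont])

section \<open>The function with second derivative \<open>- g\<close> and its weighted first
  derivative\<close>

lemma le_powr_\<gamma>: "0 \<le> s \<Longrightarrow> s \<le> 1 \<Longrightarrow> s \<le> s powr \<gamma>"
  using powr_mono'[of \<gamma> 1 s] \<gamma> by simp

text \<open>
  Up to a Gamma factor, \<open>P\<close> is the Riemann--Liouville integral of the solution and \<open>w = P'\<close> is its
  fractional derivative of order \<open>\<gamma>\<close>.
\<close>

definition w :: "real \<Rightarrow> real" where
  "w t = integral {t..1} g - (\<integral>s. (1 - (1 - s) powr \<gamma>) * \<phi> s \<partial>lborel)"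

definition P :: "real \<Rightarrow> real" where
  "P t = (\<integral>s. ((1 - s) powr \<gamma> * t - max 0 (t - s)) * \<phi> s \<partial>lborel)"

text \<open>By \<open>t - max 0 (t - s) = min s t\<close> the kernel is a difference of two terms
  lying between \<open>0\<close> and \<open>s powr \<gamma>\<close>.\<close>

lemma P_integrable:
  assumes "t \<in> {0..1}"
  shows "integrable lborel (\<lambda>s. ((1 - s) powr \<gamma> * t - max 0 (t - s)) * \<phi> s)"
proof (rule integrable_mult_\<phi>[where C = 2])
  fix s :: real assume s: "s \<in> {0<..1}"
  have "(1 - s) powr \<gamma> * t - max 0 (t - s) = min s t - t * (1 - (1 - s) powr \<gamma>)"
    by (auto simp: max_def min_def algebra_simps)
  moreover have "0 \<le> min s t" "min s t \<le> s powr \<gamma>" using s assms le_powr_\<gamma>[of s] by auto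
  moreover have "0 \<le> t * (1 - (1 - s) powr \<gamma>)" "t * (1 - (1 - s) powr \<gamma>) \<le> 1 * s powr \<gamma>"
    using one_minus_powr_bounds[OF \<gamma>, of s] s assms
      mult_mono[of t 1 "1 - (1 - s) powr \<gamma>" "s powr \<gamma>"] by auto
  ultimately show "\<bar>(1 - s) powr \<gamma> * t - max 0 (t - s)\<bar> \<le> 2 * s powr \<gamma>" by linarith
qed measurable

text \<open>The kernel is regrouped as
  \<open>s - t * (1 - (1 - s) powr \<gamma>) - max 0 (s - t)\<close>. Each summand is separately
  integrable against \<open>\<phi>\<close>, and only the last, supported in \<open>[t,1]\<close>,
  depends on \<open>t\<close> in a nonlinear way.\<close>

lemma P_eq:
  assumes t: "t \<in> {0<..1}"
  shows "P t = (\<integral>s. s * \<phi> s \<partial>lborel) - t * (\<integral>s. (1 - (1 - s) powr \<gamma>) * \<phi> s \<partial>lborel)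
    - (integral {t..1} (\<lambda>s. s * g s) - t * integral {t..1} g)"
proof -
  have i1: "integrable lborel (\<lambda>s. s * \<phi> s)"
    using le_powr_\<gamma> by (intro integrable_mult_\<phi>[where C = 1]) auto
  have i2: "integrable lborel (\<lambda>s. (1 - (1 - s) powr \<gamma>) * \<phi> s)"
    using one_minus_powr_bounds[OF \<gamma>] by (intro integrable_mult_\<phi>[where C = 1]) auto
  have i3: "integrable lborel (\<lambda>s. max 0 (s - t) * \<phi> s)"
  proof (rule integrable_mult_\<phi>[where C = 1])
    show "\<bar>max 0 (s - t)\<bar> \<le> 1 * s powr \<gamma>" if "s \<in> {0<..1}" for s
      using le_powr_\<gamma>[of s] that t by auto
  qed measurable
  have "(\<integral>s. max 0 (s - t) * \<phi> s \<partial>lborel) = (\<integral>s. indicator {t..1} s * ((s - t) * g s) \<partial>lborel)"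
    using t by (intro Bochner_Integration.integral_cong) (auto simp: \<phi>_def indicator_def)
  also have "\<dots> = integral {t..1} (\<lambda>s. (s - t) * g s)"
    using g_cont t by (intro LINT_upper_eq_integral continuous_intros)
  also have "\<dots> = integral {t..1} (\<lambda>s. s * g s) - t * integral {t..1} g"
  proof -
    have "continuous_on {t..1} g" using t by (intro continuous_on_subset[OF g_cont]) auto
    hence "g integrable_on {t..1}" "(\<lambda>s. s * g s) integrable_on {t..1}"
      by (auto intro!: integrable_continuous_real continuous_intros)
    thus ?thesis by (simp add: left_diff_distrib Henstock_Kurzweil_Integration.integral_diff
          integrable_on_mult_right)
  qed
  finally have 3: "(\<integral>s. max 0 (s - t) * \<phi> s \<partial>lborel) =
      integral {t..1} (\<lambda>s. s * g s) - t * integral {t..1} g" .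
  have "((1 - s) powr \<gamma> * t - max 0 (t - s)) * \<phi> s =
      s * \<phi> s - t * ((1 - (1 - s) powr \<gamma>) * \<phi> s) - max 0 (s - t) * \<phi> s" for s
    by (auto simp: max_def algebra_simps)
  hence "P t = (\<integral>s. s * \<phi> s - t * ((1 - (1 - s) powr \<gamma>) * \<phi> s) - max 0 (s - t) * \<phi> s \<partial>lborel)"
    by (simp only: P_def)
  also have "\<dots> = (\<integral>s. s * \<phi> s \<partial>lborel) - t * (\<integral>s. (1 - (1 - s) powr \<gamma>) * \<phi> s \<partial>lborel) -
      (\<integral>s. max 0 (s - t) * \<phi> s \<partial>lborel)"
    using i1 i2 i3 by (simp del: right_diff_distrib left_diff_distrib)
  finally show ?thesis by (simp only: 3)
qed

lemma w_DERIV: "t \<in> {0<..<1} \<Longrightarrow> (w has_real_derivative - g t) (at t)"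
  unfolding w_def[abs_def]
  by (auto intro!: derivative_eq_intros integral_upper_DERIV[OF g_cont])

lemma P_DERIV:
  assumes t: "t \<in> {0<..<1}"
  shows "(P has_real_derivative w t) (at t)"
proof (rule DERIV_cong_Ioo[OF _ t])
  have c: "continuous_on {0<..1} (\<lambda>s. s * g s)" by (intro continuous_intros g_cont)
  show "((\<lambda>t. (\<integral>s. s * \<phi> s \<partial>lborel) - t * (\<integral>s. (1 - (1 - s) powr \<gamma>) * \<phi> s \<partial>lborel)
    - (integral {t..1} (\<lambda>s. s * g s) - t * integral {t..1} g)) has_real_derivative w t) (at t)"
    \<comment> \<open>The boundary terms \<open>t * g t\<close> of the two upper integrals
      cancel.\<close>
    by (rule derivative_eq_intros refl integral_upper_DERIV[OF c t] integral_upper_DERIV[OF g_cont t])+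
       (simp add: w_def)
qed (use P_eq in auto)

text \<open>Only \<open>t = 0\<close> is delicate, since the integral of \<open>g\<close> over
  \<open>[t,1]\<close> may blow up there. For \<open>t < \<delta>\<close> and
  \<open>s \<ge> t\<close> one has \<open>t \<le> min s \<delta>\<close>, so the weighted integral
  is at most the small integral of \<open>small_min_integral\<close>.\<close>

lemma powr_w_continuous: "continuous_on {0..1} (\<lambda>t. t powr \<gamma> * w t)"
proof -
  let ?A = "\<lambda>t. integral {t..1} g"
  have cont: "continuous (at t within {0..1}) (\<lambda>t. t powr \<gamma> * ?A t)" if t: "t \<in> {0..1}" for t
  proof (cases "t = 0")
    case False
    have "continuous_on {0<..1} (\<lambda>t. t powr \<gamma> * ?A t)"
      by (intro continuous_intros integral_upper_continuous g_cont) auto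
    hence "continuous (at t within {0<..1}) (\<lambda>t. t powr \<gamma> * ?A t)"
      using t False by (auto simp: continuous_on_eq_continuous_within)
    moreover have "at t within {0..1} = at t within {0<..1}"
      using t False by (intro at_within_nhd[of _ "{0<..}"]) auto
    ultimately show ?thesis by simp
  next
    case True
    have "((\<lambda>t. t powr \<gamma> * ?A t) \<longlongrightarrow> 0) (at 0 within {0..1})"
    proof (rule tendstoI)
      fix e :: real assume "0 < e"
      then obtain \<delta> where \<delta>: "0 < \<delta>" "(\<integral>s. (min s \<delta>) powr \<gamma> * \<phi> s \<partial>lborel) < e"
        using small_min_integral by blast
      have "dist (t powr \<gamma> * ?A t) 0 < e" if t: "t \<in> {0<..1}" "t < \<delta>" for t
      proof -
        have "0 \<le> t powr \<gamma> * ?A t"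
          using t g_nonneg by (intro mult_nonneg_nonneg integral_nonneg integrable_continuous_real
              continuous_on_subset[OF g_cont]) auto
        moreover have "t powr \<gamma> * ?A t = (\<integral>s. indicator {t..1} s * (t powr \<gamma> * g s) \<partial>lborel)"
        proof -
          have "continuous_on {0<..1} (\<lambda>s. t powr \<gamma> * g s)" by (intro continuous_intros g_cont)
          from LINT_upper_eq_integral[OF this t(1)] show ?thesis by simp
        qed
        moreover have "\<dots> \<le> (\<integral>s. (min s \<delta>) powr \<gamma> * \<phi> s \<partial>lborel)"
        proof (rule integral_mono)
          have "set_integrable lborel {t..1} (\<lambda>s. t powr \<gamma> * g s)"
            using t by (intro borel_integrable_atLeastAtMost' continuous_intros
                continuous_on_subset[OF g_cont]) auto
          thus "integrable lborel (\<lambda>s. indicator {t..1} s * (t powr \<gamma> * g s))"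
            by (simp add: set_integrable_def)
          show "integrable lborel (\<lambda>s. (min s \<delta>) powr \<gamma> * \<phi> s)"
            by (rule integrable_min_powr[OF \<delta>(1)])
          show "indicator {t..1} s * (t powr \<gamma> * g s) \<le> (min s \<delta>) powr \<gamma> * \<phi> s" for s
          proof (cases "s \<in> {t..1}")
            case True
            hence "t powr \<gamma> \<le> (min s \<delta>) powr \<gamma>" using t \<gamma> by (intro powr_mono2) auto
            thus ?thesis using True t g_nonneg[of s] by (auto simp: \<phi>_eq intro!: mult_right_mono)
          qed (simp add: \<phi>_nonneg)
        qed
        ultimately show ?thesis using \<delta>(2) unfolding dist_real_def by linarith
      qed
      thus "\<forall>\<^sub>F t in at 0 within {0..1}. dist (t powr \<gamma> * ?A t) 0 < e"
        using \<delta>(1) unfolding eventually_at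
        by (intro exI[of _ \<delta>]) (auto simp: dist_real_def)
    qed
    thus ?thesis using True by (simp add: continuous_within)
  qed
  hence A: "continuous_on {0..1} (\<lambda>t. t powr \<gamma> * ?A t)"
    by (simp add: continuous_on_eq_continuous_within)
  have "continuous_on {0..1} (\<lambda>t. t powr \<gamma>)"
    using \<gamma> by (intro continuous_on_powr' continuous_intros) auto
  from continuous_on_diff[OF A continuous_on_mult[OF this continuous_on_const]]
  show ?thesis unfolding w_def right_diff_distrib .
qed

lemma V_eq_P:
  assumes "\<gamma> = 1" "t \<in> {0..1}"
  shows "V t = P t"
proof -
  have "green_kernel \<gamma> t s * \<phi> s = ((1 - s) powr \<gamma> * t - max 0 (t - s)) * \<phi> s" for s
    using assms by (cases "s \<in> {0<..1}") (auto simp: \<phi>_eq_0 green_kernel_def)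
  thus ?thesis by (simp only: V_def P_def)
qed

text \<open>Fubini moves the Abel integral onto the kernel, where it is known explicitly. The double
  integrand is nonnegative, so its absolute integrability is the integrability of the kernel of
  \<open>P\<close>.\<close>

lemma abel_integral_V:
  assumes "\<gamma> < 1" and t: "t \<in> {0<..<1}"
  shows "abel_integral \<gamma> V t = Gamma (1 + \<gamma>) * Gamma (1 - \<gamma>) * P t"
proof -
  let ?k = "\<lambda>s x. indicator {0..t} x * (green_kernel \<gamma> x s / (t - x) powr \<gamma>)"
  let ?K = "\<lambda>s. Gamma (1 + \<gamma>) * Gamma (1 - \<gamma>) * ((1 - s) powr \<gamma> * t - max 0 (t - s))"
  have k: "has_bochner_integral lborel (\<lambda>x. \<phi> s * ?k s x) (\<phi> s * ?K s)" for s
  proof (cases "s \<in> {0<..1}")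
    case True
    thus ?thesis using abel_green_kernel[of \<gamma> s t] \<gamma> assms
      by (intro has_bochner_integral_mult_right) auto
  qed (simp add: \<phi>_eq_0 has_bochner_integral_zero)
  have k0: "0 \<le> \<phi> s * ?k s x" for s x
  proof (cases "s \<in> {0<..1} \<and> x \<in> {0..t}")
    case True
    thus ?thesis using green_kernel_bounds[OF \<gamma>, of s x] t by (intro mult_nonneg_nonneg \<phi>_nonneg) auto
  qed (auto simp: \<phi>_eq_0)
  have int_K: "integrable lborel (\<lambda>s. \<phi> s * ?K s)"
    using integrable_mult_right[OF P_integrable[of t], of "Gamma (1 + \<gamma>) * Gamma (1 - \<gamma>)"] t
    by (simp add: mult_ac)
  have "abel_integral \<gamma> V t = (\<integral>x. (\<integral>s. \<phi> s * ?k s x \<partial>lborel) \<partial>lborel)"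
    unfolding abel_integral_def set_lebesgue_integral_def
  proof (intro Bochner_Integration.integral_cong refl)
    fix x
    have "(\<integral>s. \<phi> s * ?k s x \<partial>lborel) =
        (\<integral>s. indicator {0..t} x / (t - x) powr \<gamma> * (green_kernel \<gamma> x s * \<phi> s) \<partial>lborel)"
      by (intro Bochner_Integration.integral_cong) auto
    also have "\<dots> = indicator {0..t} x / (t - x) powr \<gamma> * V x"
      unfolding V_def by (rule integral_mult_right_zero)
    finally show "indicator {0..t} x *\<^sub>R (V x / (t - x) powr \<gamma>) = (\<integral>s. \<phi> s * ?k s x \<partial>lborel)"
      by (simp only: real_scaleR_def times_divide_eq_left times_divide_eq_right)
  qed
  also have "\<dots> = (\<integral>s. (\<integral>x. \<phi> s * ?k s x \<partial>lborel) \<partial>lborel)"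
  proof (rule integral_swap_lborel)
    show "(\<lambda>(s, x). \<phi> s * ?k s x) \<in> borel_measurable (lborel \<Otimes>\<^sub>M lborel)"
      unfolding green_kernel_def by measurable
    show "integrable lborel (\<lambda>x. \<phi> s * ?k s x)" for s using k by (rule integrable.intros)
    show "integrable lborel (\<lambda>s. \<integral>x. \<bar>\<phi> s * ?k s x\<bar> \<partial>lborel)"
      unfolding abs_of_nonneg[OF k0] has_bochner_integral_integral_eq[OF k] by (rule int_K)
  qed
  also have "\<dots> = (\<integral>s. Gamma (1 + \<gamma>) * Gamma (1 - \<gamma>) *
      (((1 - s) powr \<gamma> * t - max 0 (t - s)) * \<phi> s) \<partial>lborel)"
    unfolding has_bochner_integral_integral_eq[OF k] by (simp add: mult_ac)
  also have "\<dots> = Gamma (1 + \<gamma>) * Gamma (1 - \<gamma>) * P t"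
    unfolding P_def by (rule integral_mult_right_zero)
  finally show ?thesis .
qed

section \<open>The Green potential as a solution\<close>

lemma Gamma_1_plus_pos: "0 < Gamma (1 + \<gamma>)"
  using \<gamma> by (intro Gamma_real_pos) simp

lemma Gamma_order_pos: "0 < Gamma (real (RL_order \<gamma>) - \<gamma>)"
  unfolding RL_order_def using \<gamma> by (intro Gamma_real_pos) linarith

lemma RL_deriv_\<gamma>_eq:
  "RL_deriv \<gamma> u t = (deriv ^^ RL_order \<gamma>) (RL_integral \<gamma> u) t / Gamma (real (RL_order \<gamma>) - \<gamma>)"
  by (simp add: RL_deriv_def)

lemma RL_deriv_\<gamma>_add_1_eq:
  "RL_deriv (\<gamma> + 1) u t =
     deriv ((deriv ^^ RL_order \<gamma>) (RL_integral \<gamma> u)) t / Gamma (real (RL_order \<gamma>) - \<gamma>)"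
  using \<gamma> by (simp add: RL_deriv_def RL_order_add_1 RL_integral_add_1)

lemma RL_differentiable_on_\<gamma>_add_1_iff:
  "RL_differentiable_on (\<gamma> + 1) u T \<longleftrightarrow> RL_differentiable_on \<gamma> u T \<and>
     (\<forall>t\<in>T. (deriv ^^ RL_order \<gamma>) (RL_integral \<gamma> u) field_differentiable at t)"
  using \<gamma> by (auto simp: RL_differentiable_on_def RL_order_add_1 RL_integral_add_1 less_Suc_eq)

text \<open>Only the values of \<open>u\<close> on \<open>[0,1]\<close> are prescribed, so the
  results apply both to \<open>Green_op\<close> and to any function satisfying the integral equation
  on \<open>[0,1]\<close>.\<close>

context
  fixes u :: "real \<Rightarrow> real"
  assumes u: "\<And>t. t \<in> {0..1} \<Longrightarrow> u t = V t / Gamma (1 + \<gamma>)"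
begin

lemma u_cont: "continuous_on {0..1} u"
proof -
  have "continuous_on {0..1} (\<lambda>t. V t / Gamma (1 + \<gamma>))"
    using Gamma_1_plus_pos by (intro continuous_intros V_cont) auto
  thus ?thesis by (rule continuous_on_eq) (simp add: u)
qed

text \<open>For \<open>\<gamma> < 1\<close> one derivative of
  \<open>Gamma (1 - \<gamma>) * P\<close> gives \<open>w\<close>. For \<open>\<gamma> = 1\<close>
  there are two: the first undoes the plain integral and returns \<open>u = P\<close>, the second
  gives \<open>w\<close>.\<close>

lemma u_RL_differentiable_on: "RL_differentiable_on \<gamma> u {0<..<1}"
  and u_RL_integral_deriv: "t \<in> {0<..<1} \<Longrightarrow>
    (deriv ^^ RL_order \<gamma>) (RL_integral \<gamma> u) t = Gamma (real (RL_order \<gamma>) - \<gamma>) * w t"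
proof -
  have "RL_differentiable_on \<gamma> u {0<..<1} \<and> (\<forall>t\<in>{0<..<1}.
    (deriv ^^ RL_order \<gamma>) (RL_integral \<gamma> u) t = Gamma (real (RL_order \<gamma>) - \<gamma>) * w t)"
  proof (cases "\<gamma> < 1")
    case True
    have D: "(abel_integral \<gamma> u has_real_derivative Gamma (1 - \<gamma>) * w t) (at t)"
      if t: "t \<in> {0<..<1}" for t
    proof (rule DERIV_cong_Ioo[OF DERIV_cmult[OF P_DERIV[OF t]] t])
      fix s :: real assume s: "s \<in> {0<..<1}"
      have "abel_integral \<gamma> u s = (LINT x:{0..s}|lborel. V x / (s - x) powr \<gamma> / Gamma (1 + \<gamma>))"
        unfolding abel_integral_def using s u by (intro set_lebesgue_integral_cong) auto
      also have "\<dots> = abel_integral \<gamma> V s / Gamma (1 + \<gamma>)"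
        unfolding abel_integral_def by (rule set_integral_divide_zero)
      also have "\<dots> = Gamma (1 - \<gamma>) * P s"
        using abel_integral_V[OF True s] Gamma_1_plus_pos by simp
      finally show "abel_integral \<gamma> u s = Gamma (1 - \<gamma>) * P s" .
    qed
    have "abel_integral \<gamma> u field_differentiable at t" if "t \<in> {0<..<1}" for t
      using D[OF that] unfolding field_differentiable_def by blast
    thus ?thesis
      using \<gamma> True abel_integrable(1)[OF True _ _ u_cont] D
      by (auto simp: RL_differentiable_on_def RL_order_eq_1 RL_integral_eq_abel DERIV_imp_deriv)
  next
    case False
    hence \<gamma>1: "\<gamma> = 1" using \<gamma> by simp
    have u': "u t = P t" if "t \<in> {0<..<1}" for t
      using u[of t] V_eq_P[OF \<gamma>1, of t] that \<gamma>1 Gamma_numeral[of "num.Bit0 num.One", where ?'a = real]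
      by simp
    have D1: "(RL_integral 1 u has_real_derivative u t) (at t)" if t: "t \<in> {0<..<1}" for t
      using RL_1_integrable(2)[OF u_cont]
      by (intro DERIV_cong_Ioo[OF integral_lower_DERIV[OF u_cont t] t]) auto
    have D2: "(deriv (RL_integral 1 u) has_real_derivative w t) (at t)" if t: "t \<in> {0<..<1}" for t
      using D1 u' by (intro DERIV_cong_Ioo[OF P_DERIV[OF t] t]) (auto dest!: DERIV_imp_deriv)
    have "(deriv ^^ k) (RL_integral 1 u) field_differentiable at t" if "k < 2" "t \<in> {0<..<1}" for k t
    proof -
      from that(1) have "k = 0 \<or> k = 1" by linarith
      thus ?thesis using D1[OF that(2)] D2[OF that(2)] by (auto simp: field_differentiable_def)
    qed
    thus ?thesis
      using RL_1_integrable(1)[OF u_cont] D2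
      by (auto simp: \<gamma>1 RL_order_1 RL_differentiable_on_def numeral_2_eq_2 DERIV_imp_deriv)
  qed
  thus "RL_differentiable_on \<gamma> u {0<..<1}" "t \<in> {0<..<1} \<Longrightarrow>
    (deriv ^^ RL_order \<gamma>) (RL_integral \<gamma> u) t = Gamma (real (RL_order \<gamma>) - \<gamma>) * w t"
    by auto
qed

lemma u_RL_deriv: "t \<in> {0<..<1} \<Longrightarrow> RL_deriv \<gamma> u t = w t"
  using u_RL_integral_deriv Gamma_order_pos by (simp add: RL_deriv_\<gamma>_eq)

lemma u_RL_integral_DERIV:
  assumes t: "t \<in> {0<..<1}"
  shows "((deriv ^^ RL_order \<gamma>) (RL_integral \<gamma> u) has_real_derivative
    Gamma (real (RL_order \<gamma>) - \<gamma>) * (- g t)) (at t)"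
  using u_RL_integral_deriv by (intro DERIV_cong_Ioo[OF DERIV_cmult[OF w_DERIV[OF t]] t])

lemma u_abs_cont: "abs_cont_on 0 1 u"
  using u by (rule abs_cont_on_cong[OF abs_cont_on_cdivide[OF V_abs_cont Gamma_1_plus_pos]])

lemma u_in_E_space: "u \<in> E_space (\<gamma> + 1)"
  unfolding E_space_def using u_cont u_RL_differentiable_on powr_w_continuous
  by (auto simp: u_RL_deriv intro!: exI[of _ "\<lambda>t. t powr \<gamma> * w t"])

text \<open>The fractional derivative is \<open>w\<close>, and \<open>w\<close> has derivative
  \<open>- g\<close>, bounded on compact subintervals; hence \<open>w\<close> is Lipschitz
  there.\<close>

lemma u_loc_abs_cont: "loc_abs_cont (RL_deriv \<gamma> u)"
  unfolding loc_abs_cont_def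
proof (intro allI impI)
  fix c d :: real assume cd: "0 < c \<and> c \<le> d \<and> d < 1"
  have "continuous_on {c..d} g" using cd by (intro continuous_on_subset[OF g_cont]) auto
  obtain B where B: "\<And>s. s \<in> {c..d} \<Longrightarrow> \<bar>g s\<bar> \<le> B"
    using compact_imp_bounded[OF compact_continuous_image[OF \<open>continuous_on {c..d} g\<close>]]
    unfolding bounded_iff by (metis compact_Icc imageI real_norm_def)
  have "abs_cont_on c d w"
  proof (rule lipschitz_imp_abs_cont_on)
    fix x y assume xy: "c \<le> x" "x \<le> y" "y \<le> d"
    have "norm (w y - w x) \<le> B * norm (y - x)"
    proof (rule field_differentiable_bound[where S = "{c..d}" and f' = "\<lambda>z. - g z"])
      show "(w has_field_derivative - g z) (at z within {c..d})" if "z \<in> {c..d}" for z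
        using that cd by (intro has_field_derivative_at_within[OF w_DERIV]) simp
      show "norm (- g z) \<le> B" if "z \<in> {c..d}" for z using B[OF that] by simp
    qed (use xy in simp_all)
    thus "\<bar>w y - w x\<bar> \<le> B * (y - x)" using xy by simp
  qed
  thus "abs_cont_on c d (RL_deriv \<gamma> u)"
  proof (rule abs_cont_on_cong)
    show "RL_deriv \<gamma> u s = w s" if "s \<in> {c..d}" for s
      using that cd by (intro u_RL_deriv) simp
  qed
qed

lemma u_solution: "bvp_solution (\<gamma> + 1) g u"
  unfolding bvp_solution_def
proof (intro conjI ballI)
  have d: "deriv ((deriv ^^ RL_order \<gamma>) (RL_integral \<gamma> u)) t =
      Gamma (real (RL_order \<gamma>) - \<gamma>) * (- g t)" if "t \<in> {0<..<1}" for t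
    using u_RL_integral_DERIV[OF that] by (rule DERIV_imp_deriv)
  show "RL_deriv (\<gamma> + 1) u t + g t = 0" if "t \<in> {0<..<1}" for t
    using d[OF that] Gamma_order_pos by (simp add: RL_deriv_\<gamma>_add_1_eq)
  show "RL_differentiable_on (\<gamma> + 1) u {0<..<1}"
    unfolding RL_differentiable_on_\<gamma>_add_1_iff
    using u_RL_differentiable_on u_RL_integral_DERIV unfolding field_differentiable_def by blast
qed (use u_in_E_space u_abs_cont u_loc_abs_cont u[of 0] u[of 1] V_0 V_1 in auto)

end

text \<open>The equation prescribes the derivative of \<open>(deriv ^^ ?n) ?J\<close>, so successive
  integration compares \<open>u\<close> with the potential up to constants \<open>k\<close> and
  \<open>m\<close>; these are then shown to vanish.\<close>

lemma solution_unique: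
  assumes sol: "bvp_solution (\<gamma> + 1) g u" and t: "t \<in> {0..1}"
  shows "u t = V t / Gamma (1 + \<gamma>)"
proof -
  let ?n = "RL_order \<gamma>" and ?J = "RL_integral \<gamma> u"
  let ?c = "Gamma (real ?n - \<gamma>)"
  have u_E: "u \<in> E_space (\<gamma> + 1)" and bc: "u 0 = 0" "u 1 = 0"
    and diff: "RL_differentiable_on (\<gamma> + 1) u {0<..<1}"
    and eq: "\<forall>t\<in>{0<..<1}. RL_deriv (\<gamma> + 1) u t + g t = 0"
    using sol unfolding bvp_solution_def by blast+
  have u_cont: "continuous_on {0..1} u"
    using u_E by (simp only: E_space_def mem_Collect_eq)
  have "((deriv ^^ ?n) ?J has_real_derivative ?c * (- g t)) (at t)" if t: "t \<in> {0<..<1}" for t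
  proof -
    have "(deriv ^^ ?n) ?J field_differentiable at t"
      using diff t unfolding RL_differentiable_on_\<gamma>_add_1_iff by blast
    hence "((deriv ^^ ?n) ?J has_real_derivative deriv ((deriv ^^ ?n) ?J) t) (at t)"
      by (rule field_differentiable_derivI)
    moreover have "deriv ((deriv ^^ ?n) ?J) t = ?c * (- g t)"
    proof -
      have "RL_deriv (\<gamma> + 1) u t = - g t" using bspec[OF eq t] by linarith
      thus ?thesis
        unfolding RL_deriv_\<gamma>_add_1_eq using Gamma_order_pos by (simp add: field_simps)
    qed
    ultimately show ?thesis by (simp only:)
  qed
  moreover have "((\<lambda>t. ?c * w t) has_real_derivative ?c * (- g t)) (at t)" if "t \<in> {0<..<1}" for t
    using w_DERIV[OF that] by (rule DERIV_cmult)
  ultimately obtain k where k: "\<And>t. t \<in> {0<..<1} \<Longrightarrow> (deriv ^^ ?n) ?J t = ?c * w t + k"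
    by (rule DERIV_eq_on_Ioo_imp_const) auto
  have J_diff: "(deriv ^^ i) ?J field_differentiable at t" if "i < ?n" "t \<in> {0<..<1}" for i t
    using diff[unfolded RL_differentiable_on_\<gamma>_add_1_iff] that
    unfolding RL_differentiable_on_def by blast
  note Gp = Gamma_1_plus_pos
  show ?thesis
  proof (cases "\<gamma> < 1")
    case True
    have n: "?n = 1" using RL_order_eq_1 \<gamma> True by simp
    have Gm: "0 < Gamma (1 - \<gamma>)" using True by (intro Gamma_real_pos) simp
    have J: "?J = abel_integral \<gamma> u" using RL_integral_eq_abel \<gamma> True by simp
    have "(abel_integral \<gamma> u has_real_derivative Gamma (1 - \<gamma>) * w t + k) (at t)"
      if t: "t \<in> {0<..<1}" for t
      using J_diff[of 0 t] k[OF t] t field_differentiable_derivI[of "abel_integral \<gamma> u" t]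
      by (simp add: n J)
    moreover have "((\<lambda>t. Gamma (1 - \<gamma>) * P t + k * t) has_real_derivative Gamma (1 - \<gamma>) * w t + k) (at t)"
      if t: "t \<in> {0<..<1}" for t
      using P_DERIV[OF t] by (auto intro!: derivative_eq_intros)
    ultimately obtain m where
      m: "\<And>t. t \<in> {0<..<1} \<Longrightarrow> abel_integral \<gamma> u t = Gamma (1 - \<gamma>) * P t + k * t + m"
      by (rule DERIV_eq_on_Ioo_imp_const) auto
    \<comment> \<open>By \<open>abel_powr\<close>, this is the coefficient for which
      \<open>a * t powr \<gamma>\<close> has Abel integral \<open>k * t\<close>; hence the Abel
      integral of \<open>y\<close> is the constant \<open>m\<close>.\<close>
    define a where "a = k / (Gamma (1 + \<gamma>) * Gamma (1 - \<gamma>))"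
    define y where "y = (\<lambda>t. u t - V t / Gamma (1 + \<gamma>) - a * t powr \<gamma>)"
    have p_cont: "continuous_on {0..1} (\<lambda>t. t powr \<gamma>)"
      using \<gamma> by (intro continuous_on_powr' continuous_intros) auto
    have y_cont: "continuous_on {0..1} y"
      unfolding y_def using Gp by (intro continuous_intros u_cont V_cont p_cont) auto
    have y_abel: "abel_integral \<gamma> y t = m" if t: "t \<in> {0<..<1}" for t
    proof -
      have i: "set_integrable lborel {0..t} (\<lambda>s. f s / (t - s) powr \<gamma>)"
        if "continuous_on {0..1} f" for f
        using abel_integrable(1)[OF True _ _ that] t by auto
      have "abel_integral \<gamma> y t = (LINT s:{0..t}|lborel. u s / (t - s) powr \<gamma>
          - (V s / (t - s) powr \<gamma>) / Gamma (1 + \<gamma>) - a * (s powr \<gamma> / (t - s) powr \<gamma>))"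
        unfolding abel_integral_def y_def by (simp add: diff_divide_distrib mult.commute)
      also have "\<dots> = abel_integral \<gamma> u t - abel_integral \<gamma> V t / Gamma (1 + \<gamma>)
          - a * abel_integral \<gamma> (\<lambda>s. s powr \<gamma>) t"
      proof -
        note [intro] = i[OF u_cont] i[OF V_cont] i[OF p_cont]
        have 1: "set_integrable lborel {0..t} (\<lambda>s. (V s / (t - s) powr \<gamma>) / Gamma (1 + \<gamma>))"
          by (intro set_integrable_divide) auto
        have 2: "set_integrable lborel {0..t} (\<lambda>s. a * (s powr \<gamma> / (t - s) powr \<gamma>))"
          by (intro set_integrable_mult_right) auto
        note 3 = set_integral_diff[OF i[OF u_cont] 1]
        show ?thesis
          unfolding abel_integral_def set_integral_diff(2)[OF 3(1) 2] 3(2)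
            set_integral_divide_zero set_integral_mult_right ..
      qed
      also have "\<dots> = m"
        using m[OF t] abel_integral_V[OF True t] abel_powr[OF \<gamma>(1) True, of t] t Gp Gm
        by (simp add: a_def)
      finally show ?thesis .
    qed
    obtain M where M: "\<And>s. s \<in> {0..1} \<Longrightarrow> \<bar>y s\<bar> \<le> M"
      using compact_imp_bounded[OF compact_continuous_image[OF y_cont]]
      unfolding bounded_iff by (metis compact_Icc imageI real_norm_def)
    \<comment> \<open>The Abel integral of the bounded function \<open>y\<close> is at most a
      multiple of \<open>t powr (1 - \<gamma>)\<close>, so a constant value must be its limit
      \<open>0\<close> at the origin.\<close>
    have "m = 0"
    proof -
      have "((\<lambda>t. M * (t powr (1 - \<gamma>) / (1 - \<gamma>))) \<longlongrightarrow> M * (0 powr (1 - \<gamma>) / (1 - \<gamma>))) (at_right 0)"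
        using True by (intro tendsto_intros tendsto_powr') (auto simp: eventually_at_filter)
      moreover have "\<forall>\<^sub>F t in at_right 0. \<bar>m\<bar> \<le> M * (t powr (1 - \<gamma>) / (1 - \<gamma>))"
      proof -
        have "\<forall>\<^sub>F t::real in at_right 0. t \<in> {0<..<1}" by (rule eventually_at_right_real) simp
        thus ?thesis
          by eventually_elim (use abel_integrable(2)[OF True _ _ y_cont M] y_abel in force)
      qed
      ultimately have "\<bar>m\<bar> \<le> M * (0 powr (1 - \<gamma>) / (1 - \<gamma>))"
        by (rule tendsto_lowerbound) simp
      thus ?thesis by simp
    qed
    hence "y t = 0" if "t \<in> {0<..<1}" for t
      using abel_integral_eq_0_imp_eq_0[OF \<gamma>(1) True y_cont _ that] y_abel by simp
    hence y0: "y t = 0" if "t \<in> {0..1}" for t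
      using continuous_on_const_closed_interval[OF y_cont _ that] by blast
    \<comment> \<open>At \<open>t = 1\<close> both \<open>u\<close> and \<open>V\<close> vanish,
      which leaves \<open>- a = 0\<close>.\<close>
    from y0[of 1] have "a = 0" by (simp add: y_def bc V_1)
    thus ?thesis using y0[OF t] by (simp add: y_def)
  next
    case False
    hence \<gamma>1: "\<gamma> = 1" using \<gamma> by simp
    have d1: "deriv (RL_integral 1 u) t = u t" if t: "t \<in> {0<..<1}" for t
      using RL_1_integrable(2)[OF u_cont]
      by (intro DERIV_imp_deriv DERIV_cong_Ioo[OF integral_lower_DERIV[OF u_cont t] t]) auto
    have "(u has_real_derivative w t + k) (at t)" if t: "t \<in> {0<..<1}" for t
    proof (rule DERIV_cong_Ioo[OF _ t])
      show "(deriv (RL_integral 1 u) has_real_derivative w t + k) (at t)"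
        using J_diff[of 1 t] k[OF t] t field_differentiable_derivI[of "deriv (RL_integral 1 u)" t]
        by (simp add: \<gamma>1 RL_order_1 numeral_2_eq_2)
    qed (simp add: d1)
    moreover have "((\<lambda>t. P t + k * t) has_real_derivative w t + k) (at t)" if t: "t \<in> {0<..<1}" for t
      using P_DERIV[OF t] by (auto intro!: derivative_eq_intros)
    ultimately obtain m where m: "\<And>t. t \<in> {0<..<1} \<Longrightarrow> u t = P t + k * t + m"
      by (rule DERIV_eq_on_Ioo_imp_const) auto
    have "continuous_on {0..1} (\<lambda>t. u t - V t - k * t)"
      by (intro continuous_intros u_cont V_cont)
    \<comment> \<open>Continuity carries the identity to the endpoints, where \<open>u\<close> and
      \<open>V\<close> vanish; the values at \<open>0\<close> and \<open>1\<close> then give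
      \<open>m = 0\<close> and \<open>k = 0\<close>.\<close>
    hence *: "u t - V t - k * t = m" if "t \<in> {0..1}" for t
      using m V_eq_P[OF \<gamma>1] that by (rule_tac continuous_on_const_closed_interval) auto
    have "m = 0" "k = 0" using *[of 0] *[of 1] by (simp_all add: bc V_0 V_1)
    thus ?thesis
      using *[OF t] Gamma_numeral[of "num.Bit0 num.One", where ?'a = real] by (simp add: \<gamma>1)
  qed
qed

end

theorem theorem3p2:
  fixes \<alpha> :: real and g :: "real \<Rightarrow> real"
  assumes "1 < \<alpha>" and "\<alpha> \<le> 2"
    and "continuous_on {0<..1} g"
    and "\<forall>s\<in>{0<..1}. 0 \<le> g s"
    and "set_integrable lborel {0<..1} (\<lambda>s. s powr (\<alpha> - 1) * g s)"
  shows "(\<forall>t\<in>{0..1}. set_integrable lborel {0..1} (\<lambda>s. Green \<alpha> t s * g s)) \<and>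
    (\<forall>u. bvp_solution \<alpha> g u \<longleftrightarrow> (\<forall>t\<in>{0..1}. u t = Green_op \<alpha> g t)) \<and>
    abs_cont_on 0 1 (Green_op \<alpha> g) \<and>
    Green_op \<alpha> g \<in> E_space \<alpha> \<and>
    loc_abs_cont (RL_deriv (\<alpha> - 1) (Green_op \<alpha> g))"
proof -
  interpret green_bvp "\<alpha> - 1" g
    using assms by unfold_locales auto
  have \<alpha>: "\<alpha> - 1 + 1 = \<alpha>" by simp
  note Green = Green_set_integrable_and_eq[unfolded \<alpha>]
  show ?thesis
  proof (intro conjI allI)
    show "bvp_solution \<alpha> g u \<longleftrightarrow> (\<forall>t\<in>{0..1}. u t = Green_op \<alpha> g t)" for u
      using solution_unique[unfolded \<alpha>, of u] u_solution[unfolded \<alpha>, of u] Green(2) by auto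
  \<comment> \<open>Here the function \<open>u\<close> of the context is
    \<open>Green_op \<alpha> g\<close> itself, matched with \<open>V\<close> on \<open>[0,1]\<close>
    by \<open>Green(2)\<close>.\<close>
  qed (use Green u_abs_cont u_in_E_space[unfolded \<alpha>] u_loc_abs_cont in auto)
qed

end
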